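(* Let $(\Delta,X)$ be a strong combinatorial grape with $|X|>0$, and let $(\Delta^*,X)$ be its Alexander dual. (1) If $\Delta$ is simple-homotopy equivalent to the void complex, then $\Delta^*$ is a strong combinatorial grape which is simple-homotopy equivalent to the void complex. (2) If $\Delta$ is simple-homotopy equivalent to $\partial\beta_n$, then $\Delta^*$ is a strong combinatorial grape which is simple-homotopy equivalent to $\partial\beta_{|X|-n-1}$.
   Context: A simplicial complex is a pair $(\Delta,X)$ (often written just $\Delta$), where $X$ is a finite set (the ground set) and $\Delta$ is a family of subsets of $X$ closed under taking subsets. Elements of $\Delta$ are faces; $x\in X$ is a vertex of $\Delta$ if $\{x\}\in\Delta$ (not every element of $X$ need be a vertex). The void complex has no faces; the irrelevant complex is $\{\emptyset\}$. The Alexander dual of $(\Delta,X)$ is $(\Delta^*,X)$ with $\Delta^*=\{F\subseteq X: X\setminus F\notin\Delta\}$. For $a\in X$, the deletion and link are the following simplicial complexes on the ground set $X\setminus\{a\}$: $\operatorname{dl}_a(\Delta)=\{\sigma\in\Delta: a\notin\sigma\}$ and $\operatorname{lk}_a(\Delta)=\{\sigma\in\Delta: a\notin\sigma,\ \sigma\cup\{a\}\in\Delta\}$. A complex on a ground set $Y$ is a cone with apex $x\in Y$ if it has the form $\{\sigma,\ \sigma\cup\{x\} : \sigma\in\Delta'\}$ for a simplicial complex $\Delta'$ none of whose faces contains $x$. In particular, the void complex is a cone with any apex $x\in Y$. Recursively, $(\Delta,X)$ is a strong combinatorial grape if either (i) there is $a\in X$ such that at least one of $\operatorname{lk}_a(\Delta)$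 and $\operatorname{dl}_a(\Delta)$ is a cone, and both $\operatorname{dl}_a(\Delta)$ and $\operatorname{lk}_a(\Delta)$ are strong combinatorial grapes, or (ii) $\Delta$ has at most one vertex. Simple-homotopy: let $\sigma$ be a maximal face of $\Delta$ and $\tau\subset\sigma$ with $|\tau|=|\sigma|-1$ ($\tau=\emptyset$ is allowed). If $\sigma$ is the only face of $\Delta$ properly containing $\tau$, then the removal of $\sigma$ and $\tau$ is an elementary collapse; the inverse operation is an elementary expansion. Two simplicial complexes are simple-homotopy equivalent if they are related by a sequence of elementary collapses and elementary expansions. Here ground sets are disregarded: expansions may introduce new vertices, and complexes are considered up to isomorphism. For $n\ge 0$, $\partial\beta_n$ denotes the boundary of the $n$-dimensional cross-polytope: the join $S^0*\cdots*S^0$ of $n$ copies of $S^0=\{\emptyset,\{x\},\{y\}\}$ on pairwise disjoint vertex pairs (a triangulation of the $(n-1)$-dimensional sphere); $\partial\beta_0$ is the irrelevant complex $\{\emptyset\}$. *)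

theory Defs
  imports Main
begin

definition simplicial_complex :: "'a set set \<Rightarrow> 'a set \<Rightarrow> bool" where
  "simplicial_complex \<Delta> X \<longleftrightarrow>
     finite X \<and> \<Delta> \<subseteq> Pow X \<and> (\<forall>\<sigma>\<in>\<Delta>. \<forall>\<tau>. \<tau> \<subseteq> \<sigma> \<longrightarrow> \<tau> \<in> \<Delta>)"

definition vertices :: "'a set set \<Rightarrow> 'a set" where
  "vertices \<Delta> = {x. {x} \<in> \<Delta>}"

definition alexander_dual :: "'a set set \<Rightarrow> 'a set \<Rightarrow> 'a set set" where
  "alexander_dual \<Delta> X = {F. F \<subseteq> X \<and> X - F \<notin> \<Delta>}"

definition dl :: "'a \<Rightarrow> 'a set set \<Rightarrow> 'a set set" where
  "dl a \<Delta> = {\<sigma> \<in> \<Delta>. a \<notin> \<sigma>}"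

definition lk :: "'a \<Rightarrow> 'a set set \<Rightarrow> 'a set set" where
  "lk a \<Delta> = {\<sigma> \<in> \<Delta>. a \<notin> \<sigma> \<and> \<sigma> \<union> {a} \<in> \<Delta>}"

text \<open>The base \<open>\<Delta>'\<close> may be void, so the void complex on a nonempty ground set is a cone;
  the apex has to lie in the ground set, so no complex on the empty ground set is a cone.\<close>

definition cone_with_apex :: "'a set set \<Rightarrow> 'a set \<Rightarrow> 'a \<Rightarrow> bool" where
  "cone_with_apex \<Delta> Y x \<longleftrightarrow>
     x \<in> Y \<and>
     (\<exists>\<Delta>'. simplicial_complex \<Delta>' Y \<and> (\<forall>\<sigma>\<in>\<Delta>'. x \<notin> \<sigma>) \<and>
           \<Delta> = \<Delta>' \<union> (\<lambda>\<sigma>. \<sigma> \<union> {x}) ` \<Delta>')"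

definition is_cone :: "'a set set \<Rightarrow> 'a set \<Rightarrow> bool" where
  "is_cone \<Delta> Y \<longleftrightarrow> (\<exists>x. cone_with_apex \<Delta> Y x)"

inductive strong_combinatorial_grape :: "'a set set \<Rightarrow> 'a set \<Rightarrow> bool" where
  step: "\<lbrakk>simplicial_complex \<Delta> X; a \<in> X;
          is_cone (lk a \<Delta>) (X - {a}) \<or> is_cone (dl a \<Delta>) (X - {a});
          strong_combinatorial_grape (dl a \<Delta>) (X - {a});
          strong_combinatorial_grape (lk a \<Delta>) (X - {a})\<rbrakk>
         \<Longrightarrow> strong_combinatorial_grape \<Delta> X"
| base: "\<lbrakk>simplicial_complex \<Delta> X; card (vertices \<Delta>) \<le> 1\<rbrakk>
         \<Longrightarrow> strong_combinatorial_grape \<Delta> X"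

text \<open>For simple-homotopy, ground sets are disregarded: a complex \<open>K\<close> is taken on the
  ground set \<open>\<Union>K\<close>.\<close>

definition elementary_collapse :: "'a set set \<Rightarrow> 'a set set \<Rightarrow> bool" where
  "elementary_collapse K L \<longleftrightarrow>
     simplicial_complex K (\<Union>K) \<and>
     (\<exists>\<sigma>\<in>K. \<exists>\<tau>.
        (\<forall>\<rho>\<in>K. \<not> \<sigma> \<subset> \<rho>) \<and>
        \<tau> \<subset> \<sigma> \<and> Suc (card \<tau>) = card \<sigma> \<and>
        (\<forall>\<rho>\<in>K. \<tau> \<subset> \<rho> \<longrightarrow> \<rho> = \<sigma>) \<and>
        L = K - {\<sigma>, \<tau>})"

definition complex_iso :: "'a set set \<Rightarrow> 'b set set \<Rightarrow> bool" where
  "complex_iso K L \<longleftrightarrow> (\<exists>f. inj_on f (\<Union>K) \<and> L = (\<lambda>\<sigma>. f ` \<sigma>) ` K)"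

text \<open>Collapses and expansions are carried out on isomorphic copies with vertices in \<open>nat\<close>:
  the vertex types of the given complexes may be finite, while expansions must always be able
  to introduce a new vertex. Every finite complex has such a copy, and isomorphisms between
  intermediate complexes extend to permutations of \<open>nat\<close>, so they need not be listed as
  steps of their own.\<close>

definition simple_homotopy_equiv :: "'a set set \<Rightarrow> 'b set set \<Rightarrow> bool" where
  "simple_homotopy_equiv \<Delta> \<Gamma> \<longleftrightarrow>
     (\<exists>K L :: nat set set.
        complex_iso \<Delta> K \<and> complex_iso \<Gamma> L \<and> equivclp elementary_collapse K L)"

definition join :: "'a set set \<Rightarrow> 'a set set \<Rightarrow> 'a set set" where
  "join K L = {\<sigma> \<union> \<tau> | \<sigma> \<tau>. \<sigma> \<in> K \<and> \<tau> \<in> L}"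

definition S0 :: "'a \<Rightarrow> 'a \<Rightarrow> 'a set set" where
  "S0 x y = {{}, {x}, {y}}"

fun cross_polytope_boundary :: "nat \<Rightarrow> nat set set" where
  "cross_polytope_boundary 0 = {{}}"
| "cross_polytope_boundary (Suc n) =
     join (cross_polytope_boundary n) (S0 (2 * n) (2 * n + 1))"

end

theory Submission
  imports Defs
begin

text \<open>If \<open>lk a \<Delta>\<close> is a cone, then \<open>\<Delta>\<close> collapses to \<open>dl a \<Delta>\<close>; if \<open>dl a \<Delta>\<close> is a cone, then \<open>\<Delta>\<close> is
  simple-homotopy equivalent to the suspension of \<open>lk a \<Delta>\<close>. Alexander duality exchanges links
  and deletions and preserves cones, so each of the two reductions of \<open>\<Delta>\<close> corresponds to the other
  one for the dual, and the homotopy types of a grape and its dual are determined together by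
  induction. Homology modulo two is invariant under collapses and tells the void complex and
  the cross-polytope boundaries of different dimensions apart.\<close>

section \<open>Simplicial complexes, cones and duals\<close>

text \<open>The value |X| - n - 1 comes from counting suspensions. At each reduction exactly one of
  the complex and its dual is a suspension, up to equivalence, while the ground set loses one
  element. In the sphere case the two parameters therefore have a sum that changes in step with |X|.
  On one point \<open>{{}}\<close> is self-dual with both parameters 0, so the sum is always |X| -
  1. On one point the void complex and the full simplex are dual to each other, and both are
  equivalent to the void complex. On the empty ground set duality would exchange the void and the
  irrelevant complex, so the induction has to stop at one point. A second obstacle is that the
  theorem assumes some equivalence for \<Delta>, whereas the induction finds one particular pair of
  types for \<Delta> and its dual. An invariant has to show that the assumed type and the found type
  agree. Since the void complex must be told apart from \<open>{{}}\<close> too, the homology is the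
  reduced one, in which the empty face generates a chain.\<close>

lemma simplicial_complexD:
  assumes "simplicial_complex \<Delta> X"
  shows "finite X" "\<Delta> \<subseteq> Pow X" "\<And>\<sigma> \<tau>. \<sigma> \<in> \<Delta> \<Longrightarrow> \<tau> \<subseteq> \<sigma> \<Longrightarrow> \<tau> \<in> \<Delta>"
  using assms unfolding simplicial_complex_def by blast+

lemma simplicial_complexI:
  assumes "finite X" "\<Delta> \<subseteq> Pow X" "\<And>\<sigma> \<tau>. \<sigma> \<in> \<Delta> \<Longrightarrow> \<tau> \<subseteq> \<sigma> \<Longrightarrow> \<tau> \<in> \<Delta>"
  shows "simplicial_complex \<Delta> X"
  using assms unfolding simplicial_complex_def by simp

lemma simplicial_complex_finite:
  assumes "simplicial_complex \<Delta> X"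
  shows "finite \<Delta>" "\<And>\<sigma>. \<sigma> \<in> \<Delta> \<Longrightarrow> finite \<sigma>" "finite (\<Union>\<Delta>)"
proof -
  show "finite \<Delta>"
    using simplicial_complexD[OF assms] by (meson finite_Pow_iff finite_subset)
  have "\<Union>\<Delta> \<subseteq> X"
    using simplicial_complexD[OF assms] by blast
  then show "finite (\<Union>\<Delta>)"
    using simplicial_complexD[OF assms] finite_subset by blast
  then show "\<And>\<sigma>. \<sigma> \<in> \<Delta> \<Longrightarrow> finite \<sigma>"
    by (meson Union_upper finite_subset)
qed

lemma simplicial_complex_Union:
  assumes "simplicial_complex \<Delta> X"
  shows "simplicial_complex \<Delta> (\<Union>\<Delta>)"
  using simplicial_complex_finite(3)[OF assms] subset_Pow_Union simplicial_complexD(3)[OF assms]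
  by (rule simplicial_complexI)

lemma simplicial_complex_dl:
  assumes "simplicial_complex \<Delta> X"
  shows "simplicial_complex (dl a \<Delta>) (X - {a})" "simplicial_complex (dl a \<Delta>) X"
proof -
  have "\<tau> \<in> dl a \<Delta>" if "\<sigma> \<in> dl a \<Delta>" "\<tau> \<subseteq> \<sigma>" for \<sigma> \<tau>
    using that simplicial_complexD(3)[OF assms, of \<sigma> \<tau>] unfolding dl_def by blast
  moreover have "dl a \<Delta> \<subseteq> Pow (X - {a})" "dl a \<Delta> \<subseteq> Pow X"
    using simplicial_complexD(2)[OF assms] unfolding dl_def by blast+
  moreover have "finite X" "finite (X - {a})"
    using simplicial_complexD(1)[OF assms] by simp_all
  ultimately show "simplicial_complex (dl a \<Delta>) (X - {a})" "simplicial_complex (dl a \<Delta>) X"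
    by (metis simplicial_complexI)+
qed

lemma simplicial_complex_lk:
  assumes "simplicial_complex \<Delta> X"
  shows "simplicial_complex (lk a \<Delta>) (X - {a})"
proof -
  have "\<tau> \<in> lk a \<Delta>" if "\<sigma> \<in> lk a \<Delta>" "\<tau> \<subseteq> \<sigma>" for \<sigma> \<tau>
  proof -
    have "\<tau> \<union> {a} \<subseteq> \<sigma> \<union> {a}"
      using that(2) by blast
    then show ?thesis
      using that simplicial_complexD(3)[OF assms] unfolding lk_def by blast
  qed
  moreover have "lk a \<Delta> \<subseteq> Pow (X - {a})"
    using simplicial_complexD(2)[OF assms] unfolding lk_def by blast
  moreover have "finite (X - {a})"
    using simplicial_complexD(1)[OF assms] by simp
  ultimately show ?thesis
    by (metis simplicial_complexI)
qed

text \<open>The base of a cone with apex \<open>x\<close> is its deletion at \<open>x\<close>. Being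
  a cone is thus closure under inserting \<open>x\<close>, a form that passes directly to duals,
  relabellings and matchings.\<close>

lemma is_cone_iff:
  assumes "simplicial_complex \<Delta> Y"
  shows "is_cone \<Delta> Y \<longleftrightarrow> (\<exists>x\<in>Y. \<forall>\<sigma>\<in>\<Delta>. insert x \<sigma> \<in> \<Delta>)"
proof
  assume "is_cone \<Delta> Y"
  then obtain x \<Delta>' where "x \<in> Y" "\<Delta> = \<Delta>' \<union> (\<lambda>\<sigma>. \<sigma> \<union> {x}) ` \<Delta>'"
    unfolding is_cone_def cone_with_apex_def by blast
  then show "\<exists>x\<in>Y. \<forall>\<sigma>\<in>\<Delta>. insert x \<sigma> \<in> \<Delta>"
    by (intro bexI[of _ x]) auto
next
  assume "\<exists>x\<in>Y. \<forall>\<sigma>\<in>\<Delta>. insert x \<sigma> \<in> \<Delta>"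
  then obtain x where x: "x \<in> Y" "\<forall>\<sigma>\<in>\<Delta>. insert x \<sigma> \<in> \<Delta>"
    by blast
  have "simplicial_complex (dl x \<Delta>) Y"
    using simplicial_complex_dl(2)[OF assms] .
  moreover have "\<sigma> \<in> dl x \<Delta> \<union> (\<lambda>\<sigma>. \<sigma> \<union> {x}) ` dl x \<Delta>" if "\<sigma> \<in> \<Delta>" for \<sigma>
  proof (cases "x \<in> \<sigma>")
    case True
    then have "\<sigma> = (\<sigma> - {x}) \<union> {x}" by blast
    moreover have "\<sigma> - {x} \<in> dl x \<Delta>"
      using simplicial_complexD(3)[OF assms that] unfolding dl_def by blast
    ultimately show ?thesis by blast
  qed (use that in \<open>auto simp: dl_def\<close>)
  then have "\<Delta> = dl x \<Delta> \<union> (\<lambda>\<sigma>. \<sigma> \<union> {x}) ` dl x \<Delta>"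
    using x(2) unfolding dl_def by auto
  ultimately show "is_cone \<Delta> Y"
    unfolding is_cone_def cone_with_apex_def using x(1)
    by (intro exI[of _ x] conjI exI[of _ "dl x \<Delta>"]) (auto simp: dl_def)
qed

section \<open>Alexander duality for links, deletions and cones\<close>

lemma simplicial_complex_alexander_dual:
  assumes "simplicial_complex \<Delta> X"
  shows "simplicial_complex (alexander_dual \<Delta> X) X"
proof -
  have "\<tau> \<in> alexander_dual \<Delta> X" if "\<sigma> \<in> alexander_dual \<Delta> X" "\<tau> \<subseteq> \<sigma>" for \<sigma> \<tau>
    using simplicial_complexD(3)[OF assms, of "X - \<tau>" "X - \<sigma>"] that
    unfolding alexander_dual_def by blast
  moreover have "alexander_dual \<Delta> X \<subseteq> Pow X"
    unfolding alexander_dual_def by blast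
  ultimately show ?thesis
    by (metis simplicial_complexI simplicial_complexD(1)[OF assms])
qed

text \<open>The complement of \<open>F \<union> {a}\<close> in \<open>X\<close> is the complement of
  \<open>F\<close> in \<open>X - {a}\<close>. The other condition for lying in the link, that
  \<open>X - F\<close> is no face, then follows because faces are closed downwards.\<close>

lemma lk_alexander_dual:
  assumes "simplicial_complex \<Delta> X" "a \<in> X"
  shows "lk a (alexander_dual \<Delta> X) = alexander_dual (dl a \<Delta>) (X - {a})"
proof -
  have "F \<in> lk a (alexander_dual \<Delta> X) \<longleftrightarrow> F \<in> alexander_dual (dl a \<Delta>) (X - {a})" for F
  proof -
    have "X - (F \<union> {a}) = X - {a} - F"
      by blast
    moreover have "X - F \<notin> \<Delta>" if "X - {a} - F \<notin> \<Delta>"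
      using simplicial_complexD(3)[OF assms(1), of "X - F" "X - {a} - F"] that by blast
    moreover have "F \<subseteq> X - {a} \<longleftrightarrow> F \<subseteq> X \<and> a \<notin> F" "F \<union> {a} \<subseteq> X \<longleftrightarrow> F \<subseteq> X"
      using assms(2) by blast+
    ultimately show ?thesis
      by (auto simp: lk_def dl_def alexander_dual_def simp del: Un_insert_right)
  qed
  then show ?thesis
    by blast
qed

lemma dl_alexander_dual:
  assumes "simplicial_complex \<Delta> X" "a \<in> X"
  shows "dl a (alexander_dual \<Delta> X) = alexander_dual (lk a \<Delta>) (X - {a})"
proof -
  have "F \<in> dl a (alexander_dual \<Delta> X) \<longleftrightarrow> F \<in> alexander_dual (lk a \<Delta>) (X - {a})" for F
  proof -
    have "(X - {a} - F) \<union> {a} = X - F" if "a \<notin> F"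
      using that assms(2) by blast
    moreover have "X - {a} - F \<in> \<Delta>" if "X - F \<in> \<Delta>"
      using simplicial_complexD(3)[OF assms(1) that, of "X - {a} - F"] by blast
    moreover have "F \<subseteq> X - {a} \<longleftrightarrow> F \<subseteq> X \<and> a \<notin> F"
      by blast
    ultimately show ?thesis
      by (auto simp: lk_def dl_def alexander_dual_def simp del: Un_insert_right)
  qed
  then show ?thesis
    by blast
qed

text \<open>For an apex \<open>x\<close>, whether a set is a face does not depend on whether it
  contains \<open>x\<close>. Complementation preserves this, so the dual has the same apex.\<close>

lemma is_cone_alexander_dual:
  assumes "simplicial_complex \<Delta> X" "is_cone \<Delta> X"
  shows "is_cone (alexander_dual \<Delta> X) X"
proof -
  obtain x where x: "x \<in> X" "\<forall>\<sigma>\<in>\<Delta>. insert x \<sigma> \<in> \<Delta>"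
    using assms is_cone_iff by blast
  have "insert x \<sigma> \<in> alexander_dual \<Delta> X" if "\<sigma> \<in> alexander_dual \<Delta> X" for \<sigma>
  proof -
    have "X - \<sigma> \<notin> \<Delta>" "\<sigma> \<subseteq> X"
      using that by (auto simp: alexander_dual_def)
    moreover have "X - \<sigma> \<subseteq> insert x (X - insert x \<sigma>)"
      by blast
    ultimately show ?thesis
      using x simplicial_complexD(3)[OF assms(1)] unfolding alexander_dual_def by blast
  qed
  then show ?thesis
    using is_cone_iff[OF simplicial_complex_alexander_dual[OF assms(1)]] x(1) by blast
qed

section \<open>Induction on grapes, and duals of grapes\<close>

lemma grape_simplicial_complex: "strong_combinatorial_grape \<Delta> X \<Longrightarrow> simplicial_complex \<Delta> X"
  by (induction rule: strong_combinatorial_grape.induct)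

text \<open>A non-vertex of the ground set has void link, so on a ground set with at least two
  elements the base case of grapes is an instance of the recursive step.\<close>

lemma grape_induct [consumes 2, case_names singleton step]:
  assumes "strong_combinatorial_grape \<Delta> X" and "card X > 0"
    and singleton: "\<And>\<Delta> x. simplicial_complex \<Delta> {x} \<Longrightarrow> P \<Delta> {x}"
    and step: "\<And>\<Delta> X a. \<lbrakk>simplicial_complex \<Delta> X; a \<in> X; X - {a} \<noteq> {};
      is_cone (lk a \<Delta>) (X - {a}) \<or> is_cone (dl a \<Delta>) (X - {a});
      P (dl a \<Delta>) (X - {a}); P (lk a \<Delta>) (X - {a})\<rbrakk> \<Longrightarrow> P \<Delta> X"
  shows "P \<Delta> X"
proof -
  have few_vertices: "P \<Delta> X"
    if "simplicial_complex \<Delta> X" "card (vertices \<Delta>) \<le> 1" "card X = Suc n" for \<Delta> X n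
    using that
  proof (induction n arbitrary: \<Delta> X)
    case 0
    then obtain x where "X = {x}"
      by (metis One_nat_def card_1_singletonE)
    with 0 singleton show ?case by blast
  next
    case (Suc n)
    have "vertices \<Delta> \<subseteq> X"
      using simplicial_complexD(2)[OF Suc.prems(1)] unfolding vertices_def by auto
    \<comment> \<open>At this point \<open>X\<close> has at least two elements, but \<Delta> has at
      most one vertex.\<close>
    moreover have "vertices \<Delta> \<noteq> X"
      using Suc.prems by auto
    ultimately obtain a where a: "a \<in> X" "{a} \<notin> \<Delta>"
      unfolding vertices_def by blast
    have "a \<notin> \<sigma>" if "\<sigma> \<in> \<Delta>" for \<sigma>
      using simplicial_complexD(3)[OF Suc.prems(1) that, of "{a}"] a by blast
    then have eqs: "lk a \<Delta> = {}" "dl a \<Delta> = \<Delta>"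
      unfolding lk_def dl_def by blast+
    have card: "card (X - {a}) = Suc n"
      using a Suc.prems by (simp add: card_Diff_singleton)
    have sc: "simplicial_complex \<Delta> (X - {a})" "simplicial_complex {} (X - {a})"
      using simplicial_complex_dl(1)[OF Suc.prems(1), of a] eqs
        simplicial_complex_lk[OF Suc.prems(1), of a] by simp_all
    have "X - {a} \<noteq> {}"
      using card by force
    then have "is_cone {} (X - {a})"
      using is_cone_iff[OF sc(2)] by blast
    moreover have "P {} (X - {a})" "P \<Delta> (X - {a})"
      using Suc.IH[OF sc(2) _ card] Suc.IH[OF sc(1) _ card] Suc.prems
      by (simp_all add: vertices_def)
    ultimately show ?case
      using step[OF Suc.prems(1) a(1) \<open>X - {a} \<noteq> {}\<close>] eqs by simp
  qed
  show ?thesis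
    using assms(1,2)
  proof (induction rule: strong_combinatorial_grape.induct)
    case (step \<Delta> X a)
    \<comment> \<open>A cone has its apex in its ground set, so the recursive clause never descends
      to the empty ground set.\<close>
    have ne: "X - {a} \<noteq> {}"
      using step.hyps(3) unfolding is_cone_def cone_with_apex_def by blast
    moreover have "card (X - {a}) > 0"
      using ne simplicial_complexD(1)[OF step.hyps(1)] by (simp add: card_gt_0_iff)
    ultimately show ?case
      using assms(4)[of \<Delta> X a] step by blast
  next
    case (base \<Delta> X)
    then show ?case
      using few_vertices[of \<Delta> X "card X - 1"] by simp
  qed
qed

text \<open>The recursive clause is symmetric in link and deletion, and duality swaps the two; on
  one point the dual has at most one vertex for lack of room.\<close>

lemma grape_alexander_dual:
  assumes "strong_combinatorial_grape \<Delta> X" and "card X > 0"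
  shows "strong_combinatorial_grape (alexander_dual \<Delta> X) X"
  using assms
proof (induction rule: grape_induct)
  case (singleton \<Delta> x)
  have "vertices (alexander_dual \<Delta> {x}) \<subseteq> {x}"
    unfolding vertices_def alexander_dual_def by auto
  then have "card (vertices (alexander_dual \<Delta> {x})) \<le> 1"
    using card_mono[of "{x}"] by fastforce
  then show ?case
    using simplicial_complex_alexander_dual[OF singleton] strong_combinatorial_grape.base by blast
next
  case (step \<Delta> X a)
  note sc = step.hyps(1) and a = step.hyps(2)
  have "is_cone (lk a (alexander_dual \<Delta> X)) (X - {a}) \<or>
        is_cone (dl a (alexander_dual \<Delta> X)) (X - {a})"
    unfolding lk_alexander_dual[OF sc a] dl_alexander_dual[OF sc a]
    using is_cone_alexander_dual simplicial_complex_lk[OF sc] simplicial_complex_dl(1)[OF sc]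
      step.hyps(4) by blast
  then show ?case
    using strong_combinatorial_grape.step[OF simplicial_complex_alexander_dual[OF sc] a]
      step.IH lk_alexander_dual[OF sc a] dl_alexander_dual[OF sc a] by simp
qed

section \<open>Collapses\<close>

text \<open>Toggling \<open>v\<close> pairs off the faces outside \<open>L\<close>, as in an acyclic
  matching of discrete Morse theory. The pairs are removed from the top: a largest face outside
  \<open>L\<close> contains \<open>v\<close>, is maximal in \<open>K\<close>, and has its partner as
  a free face.\<close>

lemma collapse_by_matching:
  assumes "simplicial_complex K X" "simplicial_complex L X" "L \<subseteq> K"
    and "\<And>\<sigma>. \<sigma> \<in> K - L \<Longrightarrow> insert v \<sigma> \<in> K - L \<and> \<sigma> - {v} \<in> K - L"
  shows "equivclp elementary_collapse K L"
  using assms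
proof (induction "card (K - L)" arbitrary: K rule: less_induct)
  case less
  note K = less.prems(1) and L = less.prems(2) and match = less.prems(4)
  show ?case
  proof (cases "K - L = {}")
    case True
    then have "K = L" using less.prems(3) by blast
    then show ?thesis by simp
  next
    case False
    have fin: "finite (K - L)"
      using simplicial_complex_finite(1)[OF K] by blast
    define \<sigma> where "\<sigma> = arg_max_on card (K - L)"
    have \<sigma>: "\<sigma> \<in> K - L" and max: "\<And>\<rho>. \<rho> \<in> K - L \<Longrightarrow> card \<rho> \<le> card \<sigma>"
    proof -
      have "Max (card ` (K - L)) \<in> card ` (K - L)"
        using fin False by (intro Max_in) auto
      then obtain \<sigma>' where "\<sigma>' \<in> K - L" "card \<sigma>' = Max (card ` (K - L))"
        by (metis imageE)
      then have "is_arg_max card (\<lambda>\<rho>. \<rho> \<in> K - L) \<sigma>'"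
        unfolding is_arg_max_linorder using fin by auto
      then have "is_arg_max card (\<lambda>\<rho>. \<rho> \<in> K - L) \<sigma>"
        unfolding \<sigma>_def arg_max_on_def arg_max_def by (rule someI)
      then show "\<sigma> \<in> K - L" "\<And>\<rho>. \<rho> \<in> K - L \<Longrightarrow> card \<rho> \<le> card \<sigma>"
        unfolding is_arg_max_linorder by blast+
    qed
    \<comment> \<open>A face above \<sigma> cannot lie in \<open>L\<close>, which is closed
      downwards, so maximality of the cardinality among faces outside \<open>L\<close> yields
      maximality in all of \<open>K\<close>.\<close>
    have top: "\<rho> = \<sigma>" if "\<rho> \<in> K" "\<sigma> \<subseteq> \<rho>" for \<rho>
    proof -
      have "\<rho> \<in> K - L"
        using that \<sigma> simplicial_complexD(3)[OF L] by blast
      then show ?thesis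
        using max that card_seteq[of \<rho> \<sigma>] simplicial_complex_finite(2)[OF K] by blast
    qed
    have v: "v \<in> \<sigma>"
      using match[OF \<sigma>] top[of "insert v \<sigma>"] by blast
    define \<tau> where "\<tau> = \<sigma> - {v}"
    have \<tau>: "\<tau> \<in> K - L"
      using match[OF \<sigma>] \<tau>_def by blast
    \<comment> \<open>If \<rho> misses \<open>v\<close>, its partner \<open>insert v \<rho>\<close>
      contains \<sigma> and hence equals it, so \<rho> would be \<tau> itself.\<close>
    have free: "\<rho> = \<sigma>" if "\<rho> \<in> K" "\<tau> \<subset> \<rho>" for \<rho>
    proof (cases "v \<in> \<rho>")
      case True
      then show ?thesis using that top \<tau>_def by blast
    next
      case False
      have "\<rho> \<in> K - L"
        using that \<tau> simplicial_complexD(3)[OF L] by blast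
      then have "insert v \<rho> = \<sigma>"
        using match top[of "insert v \<rho>"] that \<tau>_def by blast
      then show ?thesis using that False \<tau>_def by blast
    qed
    define K' where "K' = K - {\<sigma>, \<tau>}"
    have "Suc (card \<tau>) = card \<sigma>"
      unfolding \<tau>_def using v \<sigma> simplicial_complex_finite(2)[OF K] by (metis DiffD1 card_Suc_Diff1)
    then have "elementary_collapse K K'"
      unfolding elementary_collapse_def K'_def using simplicial_complex_Union[OF K] \<sigma> v free top
      by (intro conjI bexI[of _ \<sigma>] exI[of _ \<tau>]) (auto simp: \<tau>_def)
    moreover have "equivclp elementary_collapse K' L"
    proof (rule less.hyps)
      show "card (K' - L) < card (K - L)"
        using fin \<sigma> unfolding K'_def by (intro psubset_card_mono) auto
      have "\<rho>' \<in> K'" if "\<rho> \<in> K'" "\<rho>' \<subseteq> \<rho>" for \<rho> \<rho>'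
        using that top[of \<rho>] free[of \<rho>] simplicial_complexD(3)[OF K] unfolding K'_def by blast
      moreover have "K' \<subseteq> Pow X"
        using simplicial_complexD(2)[OF K] unfolding K'_def by blast
      ultimately show "simplicial_complex K' X"
        by (metis simplicial_complexI simplicial_complexD(1)[OF K])
      show "L \<subseteq> K'"
        using less.prems(3) \<sigma> \<tau> unfolding K'_def by blast
      show "insert v \<rho> \<in> K' - L \<and> \<rho> - {v} \<in> K' - L" if "\<rho> \<in> K' - L" for \<rho>
        using match[of \<rho>] that v unfolding K'_def \<tau>_def by (auto simp: insert_absorb)
    qed (fact L)
    ultimately show ?thesis
      by (meson equivclp_trans r_into_equivclp)
  qed
qed

section \<open>Joins and cross-polytopes\<close>

text \<open>As the vertices of \<open>B\<close> lie outside \<open>Y\<close>, a face of the join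
  splits uniquely into its parts inside and outside \<open>Y\<close>.\<close>

lemma mem_join_iff:
  assumes "K \<subseteq> Pow Y" "\<Union>B \<inter> Y = {}"
  shows "\<rho> \<in> join K B \<longleftrightarrow> \<rho> \<inter> Y \<in> K \<and> \<rho> - Y \<in> B"
proof
  assume "\<rho> \<in> join K B"
  then obtain \<sigma> \<tau> where *: "\<rho> = \<sigma> \<union> \<tau>" "\<sigma> \<in> K" "\<tau> \<in> B"
    unfolding join_def by blast
  then have "\<rho> \<inter> Y = \<sigma>" "\<rho> - Y = \<tau>"
    using assms by blast+
  with * show "\<rho> \<inter> Y \<in> K \<and> \<rho> - Y \<in> B" by simp
next
  assume "\<rho> \<inter> Y \<in> K \<and> \<rho> - Y \<in> B"
  moreover have "\<rho> = (\<rho> \<inter> Y) \<union> (\<rho> - Y)" by blast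
  ultimately show "\<rho> \<in> join K B"
    unfolding join_def by blast
qed

lemma simplicial_complex_join:
  assumes "simplicial_complex K Y" "simplicial_complex B W"
  shows "simplicial_complex (join K B) (Y \<union> W)"
proof -
  have "\<rho> \<in> join K B" if "\<rho> \<subseteq> \<sigma> \<union> \<tau>" "\<sigma> \<in> K" "\<tau> \<in> B" for \<rho> \<sigma> \<tau>
  proof -
    have "\<rho> = (\<rho> \<inter> \<sigma>) \<union> (\<rho> \<inter> \<tau>)" using that by blast
    moreover have "\<rho> \<inter> \<sigma> \<in> K" "\<rho> \<inter> \<tau> \<in> B"
      using simplicial_complexD(3)[OF assms(1) that(2)] simplicial_complexD(3)[OF assms(2) that(3)]
      by simp_all
    ultimately show ?thesis unfolding join_def by blast
  qed
  then have "\<tau> \<in> join K B" if "\<sigma> \<in> join K B" "\<tau> \<subseteq> \<sigma>" for \<sigma> \<tau>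
    using that unfolding join_def[of K B] by blast
  moreover have "finite (Y \<union> W)"
    using assms simplicial_complexD(1) by blast
  moreover have "join K B \<subseteq> Pow (Y \<union> W)"
    using simplicial_complexD(2)[OF assms(1)] simplicial_complexD(2)[OF assms(2)]
    unfolding join_def by blast
  ultimately show ?thesis
    by (metis simplicial_complexI)
qed

lemma join_assoc: "join (join K L) M = join K (join L M)"
  unfolding join_def by (auto; metis Un_assoc)

lemma join_commute: "join K L = join L K"
  unfolding join_def by (auto; metis Un_commute)

lemma join_empty [simp]: "join {} B = {}" "join {{}} B = B" "join B {{}} = B"
  unfolding join_def by auto

text \<open>Toggling \<open>v\<close> changes only the part of a face inside \<open>Y\<close>, so a
  matching on \<open>K - L\<close> extends to the join with the part in \<open>B\<close> held
  fixed.\<close>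

lemma join_collapse_by_matching:
  assumes "simplicial_complex K Y" "simplicial_complex L Y" "L \<subseteq> K" "v \<in> Y"
    and match: "\<And>\<sigma>. \<sigma> \<in> K - L \<Longrightarrow> insert v \<sigma> \<in> K - L \<and> \<sigma> - {v} \<in> K - L"
    and B: "simplicial_complex B W" "\<Union>B \<inter> Y = {}"
  shows "equivclp elementary_collapse (join K B) (join L B)"
proof (rule collapse_by_matching)
  show "simplicial_complex (join K B) (Y \<union> W)" "simplicial_complex (join L B) (Y \<union> W)"
    using assms simplicial_complex_join by blast+
  show "join L B \<subseteq> join K B"
    using assms(3) unfolding join_def by blast
  note mem = mem_join_iff[OF simplicial_complexD(2)[OF assms(1)] B(2)]
    mem_join_iff[OF simplicial_complexD(2)[OF assms(2)] B(2)]
  show "insert v \<sigma> \<in> join K B - join L B \<and> \<sigma> - {v} \<in> join K B - join L B"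
    if "\<sigma> \<in> join K B - join L B" for \<sigma>
  proof -
    have "insert v \<sigma> \<inter> Y = insert v (\<sigma> \<inter> Y)" "(\<sigma> - {v}) \<inter> Y = \<sigma> \<inter> Y - {v}"
      "insert v \<sigma> - Y = \<sigma> - Y" "\<sigma> - {v} - Y = \<sigma> - Y"
      using assms(4) by blast+
    moreover have "\<sigma> \<inter> Y \<in> K - L" "\<sigma> - Y \<in> B"
      using that unfolding Diff_iff mem by blast+
    ultimately show ?thesis
      using match[of "\<sigma> \<inter> Y"] unfolding Diff_iff mem by simp
  qed
qed

text \<open>Here the vertex pairs are arbitrary, whereas \<open>cross_polytope_boundary\<close>
  fixes them as 2n and 2n+1. The suspensions in the proof use whatever vertices are at hand.\<close>

inductive cross_polytope :: "nat \<Rightarrow> 'a set set \<Rightarrow> bool" where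
  zero: "cross_polytope 0 {{}}"
| suspend: "\<lbrakk>cross_polytope n B; x \<noteq> y; x \<notin> \<Union>B; y \<notin> \<Union>B\<rbrakk>
    \<Longrightarrow> cross_polytope (Suc n) (join B (S0 x y))"

lemma mem_join_S0_iff:
  "\<rho> \<in> join B (S0 x y) \<longleftrightarrow> \<rho> \<in> B \<or> (\<exists>\<sigma>\<in>B. \<rho> = insert x \<sigma> \<or> \<rho> = insert y \<sigma>)"
  unfolding join_def S0_def mem_Collect_eq insert_iff empty_iff
  by (simp add: conj_disj_distribL conj_disj_distribR ex_disj_distrib Bex_def) metis

lemma simplicial_complex_S0: "simplicial_complex (S0 x y) {x, y}"
  unfolding simplicial_complex_def S0_def by (auto simp: subset_singleton_iff)

lemma cross_polytope_simplicial_complex: "cross_polytope n B \<Longrightarrow> simplicial_complex B (\<Union>B)"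
proof (induction rule: cross_polytope.induct)
  case zero
  show ?case by (auto simp: simplicial_complex_def)
next
  case (suspend n B x y)
  show ?case
    using simplicial_complex_Union[OF simplicial_complex_join[OF suspend.IH simplicial_complex_S0]] .
qed

lemma cross_polytope_nonempty: "cross_polytope n B \<Longrightarrow> {} \<in> B"
  by (induction rule: cross_polytope.induct) (auto simp: mem_join_S0_iff)

lemma Union_join_S0:
  assumes "{} \<in> B"
  shows "\<Union>(join B (S0 x y)) = \<Union>B \<union> {x, y}"
proof -
  have "{x} \<in> join B (S0 x y)" "{y} \<in> join B (S0 x y)"
    using assms by (auto simp: mem_join_S0_iff)
  moreover have "B \<subseteq> join B (S0 x y)"
    by (auto simp: mem_join_S0_iff)
  moreover have "\<rho> \<subseteq> \<Union>B \<union> {x, y}" if "\<rho> \<in> join B (S0 x y)" for \<rho>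
    using that unfolding mem_join_S0_iff by blast
  ultimately show ?thesis
    by blast
qed

lemma cross_polytope_card_le: "cross_polytope n B \<Longrightarrow> \<sigma> \<in> B \<Longrightarrow> card \<sigma> \<le> n"
proof (induction arbitrary: \<sigma> rule: cross_polytope.induct)
  case (suspend n B x y)
  then show ?case
    by (fastforce simp: mem_join_S0_iff intro: le_trans[OF card_insert_le_m1] card_insert_le_m1)
qed simp

lemma Union_cross_polytope_boundary:
  "\<Union>(cross_polytope_boundary n) = {..<2 * n}" "{} \<in> cross_polytope_boundary n"
proof (induction n)
  case (Suc n)
  { case 1 show ?case using Suc by (auto simp: Union_join_S0) }
  { case 2 show ?case using Suc by (auto simp: mem_join_S0_iff) }
qed auto

lemma cross_polytope_cross_polytope_boundary: "cross_polytope n (cross_polytope_boundary n)"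
proof (induction n)
  case 0
  show ?case using cross_polytope.zero by simp
next
  case (Suc n)
  show ?case
    using cross_polytope.suspend[OF Suc, of "2 * n" "2 * n + 1"]
    by (simp add: Union_cross_polytope_boundary(1) del: Union_iff)
qed

text \<open>This returns from arbitrary vertex pairs to the fixed model that occurs in the
  theorem.\<close>

lemma cross_polytope_complex_iso:
  "cross_polytope n B \<Longrightarrow> complex_iso (cross_polytope_boundary n) B"
proof (induction rule: cross_polytope.induct)
  case zero
  show ?case by (simp add: complex_iso_def)
next
  case (suspend n B x y)
  let ?C = "cross_polytope_boundary n"
  note U = Union_cross_polytope_boundary[of n]
  obtain f where f: "inj_on f {..<2 * n}" "B = (\<lambda>\<sigma>. f ` \<sigma>) ` ?C"
    using suspend.IH U unfolding complex_iso_def by auto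
  have fU: "f ` {..<2 * n} = \<Union>B"
    unfolding f(2) U(1)[symmetric] by blast
  \<comment> \<open>The newest pair of the model lies beyond the domain of \<open>f\<close>, and
    \<open>x\<close>, \<open>y\<close> lie outside its range, so the extension stays
    injective.\<close>
  define g where "g = f(2 * n := x, 2 * n + 1 := y)"
  have gf: "g i = f i" if "i < 2 * n" for i
    using that unfolding g_def by simp
  have gx: "g (2 * n) = x" "g (2 * n + 1) = y"
    unfolding g_def by simp_all
  have gim: "g ` \<sigma> = f ` \<sigma>" if "\<sigma> \<in> ?C" for \<sigma>
    using that U(1) gf by (intro image_cong) auto
  have "inj_on g {..<2 * n}"
    using f(1) gf by (simp add: inj_on_def)
  moreover have "g ` {..<2 * n} = \<Union>B"
    using fU gf by auto
  ultimately have "inj_on g ({..<2 * n} \<union> {2 * n, 2 * n + 1})"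
    using suspend.hyps gx by (auto simp: inj_on_Un)
  moreover have "\<Union>(cross_polytope_boundary (Suc n)) = {..<2 * n} \<union> {2 * n, 2 * n + 1}"
    using Union_join_S0[OF U(2)] U(1) by simp
  moreover have "join B (S0 x y) = (\<lambda>\<sigma>. g ` \<sigma>) ` cross_polytope_boundary (Suc n)"
  proof -
    have S0: "S0 x y = (\<lambda>\<sigma>. g ` \<sigma>) ` S0 (2 * n) (2 * n + 1)"
      using gx unfolding S0_def by simp
    have B: "B = (\<lambda>\<sigma>. g ` \<sigma>) ` ?C"
      using f(2) gim by (metis (no_types, lifting) image_cong)
    have "join ((\<lambda>\<sigma>. g ` \<sigma>) ` K) ((\<lambda>\<sigma>. g ` \<sigma>) ` L) = (\<lambda>\<sigma>. g ` \<sigma>) ` join K L" for K L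
    proof (intro set_eqI iffI)
      fix \<rho> assume "\<rho> \<in> join ((`) g ` K) ((`) g ` L)"
      then obtain \<sigma> \<tau> where "\<rho> = g ` (\<sigma> \<union> \<tau>)" "\<sigma> \<in> K" "\<tau> \<in> L"
        unfolding join_def by (auto simp: image_Un)
      then show "\<rho> \<in> (`) g ` join K L"
        unfolding join_def by blast
    next
      fix \<rho> assume "\<rho> \<in> (`) g ` join K L"
      then obtain \<sigma> \<tau> where "\<rho> = g ` \<sigma> \<union> g ` \<tau>" "\<sigma> \<in> K" "\<tau> \<in> L"
        unfolding join_def by (auto simp: image_Un)
      then show "\<rho> \<in> join ((`) g ` K) ((`) g ` L)"
        unfolding join_def by blast
    qed
    then show ?thesis
      using S0 B by simp
  qed
  ultimately show ?case
    unfolding complex_iso_def by metis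
qed

section \<open>Homotopy types of grapes\<close>

text \<open>The value \<open>None\<close> stands for the void complex and \<open>Some n\<close> for the boundary of the
  \<open>n\<close>-dimensional cross-polytope. Quantifying over the joins with all cross-polytopes \<open>B\<close>
  keeps the vertices used for suspending disjoint from all the others, so that no
  sequence of collapses and expansions ever has to be suspended.\<close>

definition homotopy_type :: "nat set set \<Rightarrow> nat set \<Rightarrow> nat option \<Rightarrow> bool" where
  "homotopy_type \<Gamma> Y t \<longleftrightarrow>
     (\<forall>k B. cross_polytope k B \<and> \<Union>B \<inter> Y = {} \<longrightarrow>
        (\<exists>L. equivclp elementary_collapse (join \<Gamma> B) L \<and>
          (case t of None \<Rightarrow> L = {} | Some n \<Rightarrow> cross_polytope (k + n) L)))"

lemma homotopy_typeD:
  assumes "homotopy_type \<Gamma> Y t" "cross_polytope k B" "\<Union>B \<inter> Y = {}"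
  obtains L where "equivclp elementary_collapse (join \<Gamma> B) L"
    "case t of None \<Rightarrow> L = {} | Some n \<Rightarrow> cross_polytope (k + n) L"
  using assms unfolding homotopy_type_def by blast

text \<open>Toggling the apex matches all faces, the empty one included, so the collapse leaves the
  void complex.\<close>

lemma homotopy_type_cone:
  assumes "simplicial_complex \<Gamma> Y" "is_cone \<Gamma> Y"
  shows "homotopy_type \<Gamma> Y None"
proof -
  obtain x where x: "x \<in> Y" "\<forall>\<sigma>\<in>\<Gamma>. insert x \<sigma> \<in> \<Gamma>"
    using assms is_cone_iff by blast
  have "simplicial_complex {} Y"
    using simplicial_complexD(1)[OF assms(1)] by (intro simplicial_complexI) auto
  then have "equivclp elementary_collapse (join \<Gamma> B) (join {} B)"
    if "cross_polytope k B" "\<Union>B \<inter> Y = {}" for k and B :: "nat set set"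
    using join_collapse_by_matching[OF assms(1) _ _ x(1) _
        cross_polytope_simplicial_complex[OF that(1)] that(2), of "{}"]
      x(2) simplicial_complexD(3)[OF assms(1)] by blast
  then show ?thesis
    unfolding homotopy_type_def by auto
qed

lemma homotopy_type_irrelevant: "homotopy_type {{}} Y (Some 0)"
  unfolding homotopy_type_def by auto

text \<open>The faces outside the deletion are those containing \<open>a\<close>, that is, the faces
  of the link with \<open>a\<close> added. An apex of the link therefore matches them.\<close>

lemma join_dl_collapse:
  assumes "simplicial_complex \<Gamma> Y" "a \<in> Y" "is_cone (lk a \<Gamma>) (Y - {a})"
    "simplicial_complex B W" "\<Union>B \<inter> Y = {}"
  shows "equivclp elementary_collapse (join \<Gamma> B) (join (dl a \<Gamma>) B)"
proof -
  obtain x where x: "x \<in> Y - {a}" "\<forall>\<sigma>\<in>lk a \<Gamma>. insert x \<sigma> \<in> lk a \<Gamma>"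
    using assms(3) is_cone_iff[OF simplicial_complex_lk[OF assms(1)]] by blast
  show ?thesis
  proof (rule join_collapse_by_matching[OF assms(1) _ _ _ _ assms(4,5)])
    show "simplicial_complex (dl a \<Gamma>) Y"
      using simplicial_complex_dl(2)[OF assms(1)] .
    show "dl a \<Gamma> \<subseteq> \<Gamma>" by (auto simp: dl_def)
    show "x \<in> Y" using x by blast
    show "insert x \<sigma> \<in> \<Gamma> - dl a \<Gamma> \<and> \<sigma> - {x} \<in> \<Gamma> - dl a \<Gamma>"
      if "\<sigma> \<in> \<Gamma> - dl a \<Gamma>" for \<sigma>
    proof -
      have \<sigma>: "\<sigma> \<in> \<Gamma>" "a \<in> \<sigma>"
        using that by (auto simp: dl_def)
      then have "\<sigma> - {a} \<in> lk a \<Gamma>"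
        using simplicial_complexD(3)[OF assms(1) \<sigma>(1)] unfolding lk_def
        by (auto simp: insert_absorb)
      then have "insert x (\<sigma> - {a}) \<union> {a} \<in> \<Gamma>"
        using x unfolding lk_def by blast
      moreover have "insert x (\<sigma> - {a}) \<union> {a} = insert x \<sigma>"
        using \<sigma> by blast
      ultimately show ?thesis
        using x(1) \<sigma> simplicial_complexD(3)[OF assms(1) \<sigma>(1)] unfolding dl_def by auto
    qed
  qed
qed

lemma homotopy_type_lk_cone:
  assumes "simplicial_complex \<Gamma> Y" "a \<in> Y" "is_cone (lk a \<Gamma>) (Y - {a})"
    "homotopy_type (dl a \<Gamma>) (Y - {a}) t"
  shows "homotopy_type \<Gamma> Y t"
  unfolding homotopy_type_def
proof (intro allI impI)
  fix k :: nat and B :: "nat set set"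
  assume B: "cross_polytope k B \<and> \<Union>B \<inter> Y = {}"
  then have "\<Union>B \<inter> (Y - {a}) = {}" by blast
  with B obtain L where "equivclp elementary_collapse (join (dl a \<Gamma>) B) L"
    "case t of None \<Rightarrow> L = {} | Some n \<Rightarrow> cross_polytope (k + n) L"
    using homotopy_typeD[OF assms(4)] by blast
  then show "\<exists>L. equivclp elementary_collapse (join \<Gamma> B) L \<and>
      (case t of None \<Rightarrow> L = {} | Some n \<Rightarrow> cross_polytope (k + n) L)"
    using join_dl_collapse[OF assms(1-3)] B cross_polytope_simplicial_complex equivclp_trans
    by metis
qed

text \<open>Gluing the cone with a new apex \<open>b\<close> over the contractible deletion does not change
  the homotopy type; matching along \<open>b\<close> then leaves the suspension of the link.\<close>

lemma join_suspend_lk_collapse: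
  assumes "simplicial_complex \<Gamma> Y" "a \<in> Y" "is_cone (dl a \<Gamma>) (Y - {a})" "b \<notin> Y"
    and B: "simplicial_complex B W" "\<Union>B \<inter> insert b Y = {}"
  shows "equivclp elementary_collapse (join \<Gamma> B) (join (lk a \<Gamma>) (join B (S0 a b)))"
proof -
  let ?Y = "insert b Y"
  define \<Gamma>' where "\<Gamma>' = \<Gamma> \<union> insert b ` dl a \<Gamma>"
  note down = simplicial_complexD(3)[OF assms(1)]
  have b: "b \<notin> \<sigma>" if "\<sigma> \<in> \<Gamma>" for \<sigma>
    using that assms(4) simplicial_complexD(2)[OF assms(1)] by blast
  \<comment> \<open>\<open>\<Gamma>'\<close> has the new vertex \<open>b\<close> as a second copy of
    a pole: a face may not contain both \<open>a\<close> and \<open>b\<close>.\<close>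
  have mem: "\<rho> \<in> \<Gamma>' \<longleftrightarrow> \<rho> - {b} \<in> \<Gamma> \<and> (b \<in> \<rho> \<longrightarrow> a \<notin> \<rho>)" for \<rho>
  proof
    assume "\<rho> \<in> \<Gamma>'"
    then show "\<rho> - {b} \<in> \<Gamma> \<and> (b \<in> \<rho> \<longrightarrow> a \<notin> \<rho>)"
      unfolding \<Gamma>'_def dl_def using b assms(2,4) by auto
  next
    assume *: "\<rho> - {b} \<in> \<Gamma> \<and> (b \<in> \<rho> \<longrightarrow> a \<notin> \<rho>)"
    show "\<rho> \<in> \<Gamma>'"
    proof (cases "b \<in> \<rho>")
      case True
      then have "\<rho> = insert b (\<rho> - {b})" "\<rho> - {b} \<in> dl a \<Gamma>"
        using * by (auto simp: dl_def)
      then show ?thesis unfolding \<Gamma>'_def by blast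
    qed (use * in \<open>auto simp: \<Gamma>'_def\<close>)
  qed
  have sc: "simplicial_complex \<Gamma>' ?Y"
  proof -
    have "\<tau> \<in> \<Gamma>'" if "\<sigma> \<in> \<Gamma>'" "\<tau> \<subseteq> \<sigma>" for \<sigma> \<tau>
      using that down[of "\<sigma> - {b}" "\<tau> - {b}"] unfolding mem by blast
    moreover have "\<Gamma>' \<subseteq> Pow ?Y"
      using simplicial_complexD(2)[OF assms(1)] unfolding \<Gamma>'_def dl_def by blast
    ultimately show ?thesis
      by (metis simplicial_complexI simplicial_complexD(1)[OF assms(1)] finite_insert)
  qed
  have Y: "?Y - {b} = Y"
    using assms(4) by blast
  have dl: "dl b \<Gamma>' = \<Gamma>"
    using b unfolding \<Gamma>'_def dl_def by blast
  have lk: "lk b \<Gamma>' = dl a \<Gamma>"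
  proof (intro set_eqI iffI)
    fix \<sigma> assume "\<sigma> \<in> lk b \<Gamma>'"
    then have *: "b \<notin> \<sigma>" "\<sigma> - {b} \<in> \<Gamma>" "a \<notin> \<sigma>"
      unfolding lk_def mem by blast+
    from *(1) have "\<sigma> - {b} = \<sigma>"
      by blast
    then have "\<sigma> \<in> \<Gamma>"
      using *(2) by metis
    with *(3) show "\<sigma> \<in> dl a \<Gamma>"
      unfolding dl_def by simp
  next
    fix \<sigma> assume "\<sigma> \<in> dl a \<Gamma>"
    then have *: "\<sigma> \<in> \<Gamma>" "a \<notin> insert b \<sigma>"
      using assms(2,4) unfolding dl_def by auto
    moreover have "insert b \<sigma> - {b} = \<sigma>" "\<sigma> - {b} = \<sigma>"
      using b[OF *(1)] by blast+
    ultimately show "\<sigma> \<in> lk b \<Gamma>'"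
      using b[OF *(1)] unfolding lk_def mem by simp
  qed
  \<comment> \<open>The deletion of \<open>a\<close> is the link of \<open>b\<close> in
    \<open>\<Gamma>'\<close>; its ground set there is \<open>Y\<close>, still containing
    \<open>a\<close>, and the apex remains the same. Hence \<open>\<Gamma>'\<close> collapses to
    \<open>\<Gamma>\<close>.\<close>
  have "is_cone (dl a \<Gamma>) Y"
    using assms(3) is_cone_iff[OF simplicial_complex_dl(1)[OF assms(1), of a]]
      is_cone_iff[OF simplicial_complex_dl(2)[OF assms(1), of a]] by blast
  then have "is_cone (lk b \<Gamma>') (?Y - {b})"
    unfolding lk Y .
  then have "equivclp elementary_collapse (join \<Gamma>' B) (join \<Gamma> B)"
    using join_dl_collapse[OF sc insertI1 _ B] unfolding dl by simp
  moreover
  have "equivclp elementary_collapse (join \<Gamma>' B) (join (join (lk a \<Gamma>) (S0 a b)) B)"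
  proof (rule join_collapse_by_matching[OF sc _ _ _ _ B])
    let ?\<Sigma> = "join (lk a \<Gamma>) (S0 a b)"
    have ab: "a \<noteq> b" using assms(2,4) by blast
    have lkb: "a \<notin> \<sigma> \<and> b \<notin> \<sigma>" if "\<sigma> \<in> lk a \<Gamma>" for \<sigma>
      using that b unfolding lk_def by blast
    have mem\<Sigma>: "\<rho> \<in> ?\<Sigma> \<longleftrightarrow> \<rho> - {a, b} \<in> lk a \<Gamma> \<and> (b \<in> \<rho> \<longrightarrow> a \<notin> \<rho>)" for \<rho>
    proof
      assume "\<rho> \<in> ?\<Sigma>"
      then obtain \<sigma> where \<sigma>: "\<sigma> \<in> lk a \<Gamma>" "\<rho> = \<sigma> \<or> \<rho> = insert a \<sigma> \<or> \<rho> = insert b \<sigma>"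
        unfolding mem_join_S0_iff by blast
      then have "\<rho> - {a, b} = \<sigma>" "b \<in> \<rho> \<longrightarrow> a \<notin> \<rho>"
        using lkb[OF \<sigma>(1)] ab by auto
      with \<sigma>(1) show "\<rho> - {a, b} \<in> lk a \<Gamma> \<and> (b \<in> \<rho> \<longrightarrow> a \<notin> \<rho>)"
        by simp
    next
      assume *: "\<rho> - {a, b} \<in> lk a \<Gamma> \<and> (b \<in> \<rho> \<longrightarrow> a \<notin> \<rho>)"
      then have "\<rho> = \<rho> - {a, b} \<or> \<rho> = insert a (\<rho> - {a, b}) \<or> \<rho> = insert b (\<rho> - {a, b})"
        by blast
      with * show "\<rho> \<in> ?\<Sigma>"
        unfolding mem_join_S0_iff by metis
    qed
    have "simplicial_complex ?\<Sigma> ((Y - {a}) \<union> {a, b})"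
      using simplicial_complex_join[OF simplicial_complex_lk[OF assms(1)] simplicial_complex_S0] .
    moreover have "(Y - {a}) \<union> {a, b} = ?Y"
      using assms(2) by blast
    ultimately show "simplicial_complex ?\<Sigma> ?Y"
      by simp
    show "?\<Sigma> \<subseteq> \<Gamma>'"
    proof
      fix \<rho> assume "\<rho> \<in> ?\<Sigma>"
      then have *: "\<rho> - {a, b} \<in> lk a \<Gamma>" "b \<in> \<rho> \<longrightarrow> a \<notin> \<rho>"
        unfolding mem\<Sigma> by simp_all
      then have "(\<rho> - {a, b}) \<union> {a} \<in> \<Gamma>"
        by (simp add: lk_def)
      moreover have "\<rho> - {b} \<subseteq> (\<rho> - {a, b}) \<union> {a}"
        by blast
      ultimately have "\<rho> - {b} \<in> \<Gamma>"
        by (rule down)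
      with *(2) show "\<rho> \<in> \<Gamma>'"
        unfolding mem by simp
    qed
    show "b \<in> ?Y" by simp
    show "insert b \<sigma> \<in> \<Gamma>' - ?\<Sigma> \<and> \<sigma> - {b} \<in> \<Gamma>' - ?\<Sigma>" if "\<sigma> \<in> \<Gamma>' - ?\<Sigma>" for \<sigma>
    proof -
      have \<sigma>: "\<sigma> - {b} \<in> \<Gamma>" "b \<in> \<sigma> \<longrightarrow> a \<notin> \<sigma>" "\<sigma> - {a, b} \<notin> lk a \<Gamma>"
        using that unfolding mem mem\<Sigma> Diff_iff by blast+
      \<comment> \<open>If \<open>a\<close> were present, the rest of the face would be in the link
        and the face in the suspension. With \<open>a\<close> absent, toggling \<open>b\<close>
        affects neither membership.\<close>
      have "a \<notin> \<sigma>"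
      proof
        assume "a \<in> \<sigma>"
        then have "(\<sigma> - {a, b}) \<union> {a} = \<sigma> - {b}"
          using ab by blast
        then have "\<sigma> - {a, b} \<in> lk a \<Gamma>"
          using \<sigma>(1) down[OF \<sigma>(1), of "\<sigma> - {a, b}"] unfolding lk_def by auto
        with \<sigma>(3) show False by blast
      qed
      moreover have "insert b \<sigma> - {b} = \<sigma> - {b}" "insert b \<sigma> - {a, b} = \<sigma> - {a, b}"
        "\<sigma> - {b} - {b} = \<sigma> - {b}" "\<sigma> - {b} - {a, b} = \<sigma> - {a, b}"
        by blast+
      ultimately show ?thesis
        using \<sigma> ab unfolding mem mem\<Sigma> Diff_iff by simp
    qed
  qed
  \<comment> \<open>The suspending pair moves from the link to \<open>B\<close>, giving a join of
    the kind that \<open>homotopy_type\<close> quantifies over.\<close>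
  moreover have "join (join (lk a \<Gamma>) (S0 a b)) B = join (lk a \<Gamma>) (join B (S0 a b))"
    by (simp only: join_assoc join_commute[of B])
  ultimately show ?thesis
    using equivclp_trans[OF equivclp_sym] by simp
qed

lemma homotopy_type_dl_cone:
  assumes "simplicial_complex \<Gamma> Y" "a \<in> Y" "is_cone (dl a \<Gamma>) (Y - {a})"
    "homotopy_type (lk a \<Gamma>) (Y - {a}) t"
  shows "homotopy_type \<Gamma> Y (map_option Suc t)"
  unfolding homotopy_type_def
proof (intro allI impI)
  fix k :: nat and B :: "nat set set"
  assume B: "cross_polytope k B \<and> \<Union>B \<inter> Y = {}"
  then have scB: "simplicial_complex B (\<Union>B)"
    using cross_polytope_simplicial_complex by blast
  have "finite (Y \<union> \<Union>B)"
    using simplicial_complexD(1)[OF scB] simplicial_complexD(1)[OF assms(1)] by blast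
  then obtain b where b: "b \<notin> Y" "b \<notin> \<Union>B"
    using ex_new_if_finite[OF infinite_UNIV_nat] by blast
  have "a \<noteq> b" "a \<notin> \<Union>B"
    using B b(1) assms(2) by blast+
  then have "cross_polytope (Suc k) (join B (S0 a b))"
    using cross_polytope.suspend B b(2) by metis
  moreover have "\<Union>(join B (S0 a b)) \<inter> (Y - {a}) = {}"
    using Union_join_S0[OF cross_polytope_nonempty, of k B a b] B b(1) by auto
  ultimately obtain L where L: "equivclp elementary_collapse (join (lk a \<Gamma>) (join B (S0 a b))) L"
    "case t of None \<Rightarrow> L = {} | Some n \<Rightarrow> cross_polytope (Suc k + n) L"
    by (rule homotopy_typeD[OF assms(4)])
  have "\<Union>B \<inter> insert b Y = {}"
    using B b(2) by blast
  then have "equivclp elementary_collapse (join \<Gamma> B) L"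
    using equivclp_trans[OF join_suspend_lk_collapse[OF assms(1-3) b(1) scB] L(1)] by blast
  then show "\<exists>L. equivclp elementary_collapse (join \<Gamma> B) L \<and>
      (case map_option Suc t of None \<Rightarrow> L = {} | Some n \<Rightarrow> cross_polytope (k + n) L)"
    using L(2) by (intro exI[of _ L]) (auto split: option.splits)
qed

text \<open>Choosing \<open>B = {{}}\<close> and \<open>k = 0\<close> makes the join trivial, and
  \<open>f\<close> supplies the isomorphic copy on \<open>nat\<close>.\<close>

lemma homotopy_type_simple_homotopy_equiv:
  assumes "homotopy_type ((`) f ` \<Delta>) (f ` X) t" "inj_on f X" "simplicial_complex \<Delta> X"
  shows "case t of None \<Rightarrow> simple_homotopy_equiv \<Delta> ({} :: nat set set)
    | Some n \<Rightarrow> simple_homotopy_equiv \<Delta> (cross_polytope_boundary n)"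
proof -
  have "inj_on f (\<Union>\<Delta>)"
    using assms(2) simplicial_complexD(2)[OF assms(3)] inj_on_subset by (metis Sup_le_iff PowD subsetD)
  then have iso: "complex_iso \<Delta> ((`) f ` \<Delta>)"
    unfolding complex_iso_def by blast
  obtain L where "equivclp elementary_collapse ((`) f ` \<Delta>) L"
    "case t of None \<Rightarrow> L = {} | Some n \<Rightarrow> cross_polytope n L"
    by (rule homotopy_typeD[OF assms(1) cross_polytope.zero]) (auto split: option.splits)
  moreover have "complex_iso {} ({} :: nat set set)"
    unfolding complex_iso_def by simp
  ultimately show ?thesis
    using iso cross_polytope_complex_iso unfolding simple_homotopy_equiv_def
    by (auto split: option.splits)
qed

section \<open>Relabelling vertices injectively\<close>

lemma simplicial_complex_image:
  assumes "simplicial_complex \<Delta> X"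
  shows "simplicial_complex ((`) f ` \<Delta>) (f ` X)"
proof -
  have "\<tau> \<in> (`) f ` \<Delta>" if "\<sigma> \<in> \<Delta>" "\<tau> \<subseteq> f ` \<sigma>" for \<sigma> \<tau>
    using that simplicial_complexD(3)[OF assms that(1)] by (metis image_iff subset_imageE)
  then have "\<tau> \<in> (`) f ` \<Delta>" if "\<sigma> \<in> (`) f ` \<Delta>" "\<tau> \<subseteq> \<sigma>" for \<sigma> \<tau>
    using that by blast
  moreover have "(`) f ` \<Delta> \<subseteq> Pow (f ` X)" "finite (f ` X)"
    using simplicial_complexD(1,2)[OF assms] by auto
  ultimately show ?thesis
    by (metis simplicial_complexI)
qed

lemma is_cone_image:
  assumes "simplicial_complex \<Delta> X" "is_cone \<Delta> X"
  shows "is_cone ((`) f ` \<Delta>) (f ` X)"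
  using assms is_cone_iff[OF assms(1)] is_cone_iff[OF simplicial_complex_image[OF assms(1)]]
  by (auto simp flip: image_insert)

context
  fixes f :: "'a \<Rightarrow> 'b" and \<Delta> X a
  assumes inj: "inj_on f X" and sc: "simplicial_complex \<Delta> X" and a: "a \<in> X"
begin

lemma image_mem_iff: "\<sigma> \<in> \<Delta> \<Longrightarrow> f a \<in> f ` \<sigma> \<longleftrightarrow> a \<in> \<sigma>"
  using inj a simplicial_complexD(2)[OF sc] by (meson PowD inj_on_image_mem_iff subsetD)

lemma dl_image: "dl (f a) ((`) f ` \<Delta>) = (`) f ` dl a \<Delta>"
  using image_mem_iff unfolding dl_def by auto

lemma lk_image: "lk (f a) ((`) f ` \<Delta>) = (`) f ` lk a \<Delta>"
proof -
  have "\<sigma> \<union> {a} \<in> \<Delta>" if \<sigma>: "\<sigma> \<in> \<Delta>" "f ` \<sigma> \<union> {f a} \<in> (`) f ` \<Delta>" for \<sigma>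
  proof -
    obtain \<rho> where \<rho>: "\<rho> \<in> \<Delta>" "f ` (\<sigma> \<union> {a}) = f ` \<rho>"
      using \<sigma>(2) by auto
    then have "\<sigma> \<union> {a} = \<rho>"
      using inj_on_image_eq_iff[OF inj, of "\<sigma> \<union> {a}" \<rho>] \<sigma>(1) a simplicial_complexD(2)[OF sc]
      by blast
    with \<rho> show ?thesis by simp
  qed
  moreover have "f ` \<sigma> \<union> {f a} \<in> (`) f ` \<Delta>" if "\<sigma> \<union> {a} \<in> \<Delta>" for \<sigma>
    using that by (metis image_Un image_empty image_eqI image_insert)
  ultimately show ?thesis
    using image_mem_iff unfolding lk_def by blast
qed

lemma image_Diff_singleton: "f ` (X - {a}) = f ` X - {f a}"
  using inj a by (simp add: inj_on_image_set_diff[of f X])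

end

lemma homotopy_type_image_lk_cone:
  assumes "inj_on f X" "simplicial_complex \<Delta> X" "a \<in> X" "is_cone (lk a \<Delta>) (X - {a})"
    "homotopy_type ((`) f ` dl a \<Delta>) (f ` (X - {a})) t"
  shows "homotopy_type ((`) f ` \<Delta>) (f ` X) t"
  using homotopy_type_lk_cone[OF simplicial_complex_image[OF assms(2)], of "f a"] assms(3,5)
    is_cone_image[OF simplicial_complex_lk[OF assms(2)] assms(4), of f]
    dl_image[OF assms(1-3)] lk_image[OF assms(1-3)] image_Diff_singleton[OF assms(1-3)]
  by simp

lemma homotopy_type_image_dl_cone:
  assumes "inj_on f X" "simplicial_complex \<Delta> X" "a \<in> X" "is_cone (dl a \<Delta>) (X - {a})"
    "homotopy_type ((`) f ` lk a \<Delta>) (f ` (X - {a})) t"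
  shows "homotopy_type ((`) f ` \<Delta>) (f ` X) (map_option Suc t)"
  using homotopy_type_dl_cone[OF simplicial_complex_image[OF assms(2)], of "f a"] assms(3,5)
    is_cone_image[OF simplicial_complex_dl(1)[OF assms(2)] assms(4), of f]
    dl_image[OF assms(1-3)] lk_image[OF assms(1-3)] image_Diff_singleton[OF assms(1-3)]
  by simp

text \<open>The induction runs over the original vertex type; \<open>f\<close> relabels only the
  complexes that are to be collapsed, which live on \<open>nat\<close>. The bound on
  \<open>n\<close> is carried along so that the truncated subtraction is a true one.\<close>

lemma grape_homotopy_types:
  assumes "strong_combinatorial_grape \<Delta> X" and "card X > 0" and "inj_on f X"
  shows "\<exists>t. homotopy_type ((`) f ` \<Delta>) (f ` X) t \<and>
    homotopy_type ((`) f ` alexander_dual \<Delta> X) (f ` X) (map_option (\<lambda>n. card X - n - 1) t) \<and>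
    (\<forall>n. t = Some n \<longrightarrow> n < card X)"
  using assms
proof (induction rule: grape_induct)
  case (singleton \<Delta> x)
  have "\<Delta> \<subseteq> {{}, {x}}"
    using simplicial_complexD(2)[OF singleton(1)] by auto
  moreover have "{} \<in> \<Delta>" if "{x} \<in> \<Delta>"
    using that simplicial_complexD(3)[OF singleton(1) that] by blast
  ultimately have "\<Delta> = {} \<or> \<Delta> = {{}} \<or> \<Delta> = {{}, {x}}"
    by blast
  moreover have subs: "F \<subseteq> {x} \<longleftrightarrow> F = {} \<or> F = {x}" for F
    by blast
  \<comment> \<open>Void complex and full simplex are exchanged and both have type
    \<open>None\<close>; the irrelevant complex is self-dual, in accordance with 0 = 1 - 0 -
    1.\<close>
  have "alexander_dual {} {x} = {{}, {x}}" "alexander_dual {{}} {x} = {{}}"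
    "alexander_dual {{}, {x}} {x} = {}"
    unfolding alexander_dual_def subs by auto
  moreover have void: "homotopy_type {} {f x} None"
    unfolding homotopy_type_def by auto
  moreover have point: "homotopy_type {{}, {f x}} {f x} None"
  proof (rule homotopy_type_cone)
    show sc: "simplicial_complex {{}, {f x}} {f x}"
      unfolding simplicial_complex_def by auto
    show "is_cone {{}, {f x}} {f x}"
      unfolding is_cone_iff[OF sc] by auto
  qed
  moreover note homotopy_type_irrelevant[of "{f x}"]
  ultimately consider "homotopy_type ((`) f ` \<Delta>) {f x} None"
      "homotopy_type ((`) f ` alexander_dual \<Delta> {x}) {f x} None"
    | "homotopy_type ((`) f ` \<Delta>) {f x} (Some 0)"
      "homotopy_type ((`) f ` alexander_dual \<Delta> {x}) {f x} (Some 0)"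
    by fastforce
  then show ?case
  proof cases
    case 1
    then show ?thesis by (intro exI[of _ None]) simp
  next
    case 2
    then show ?thesis by (intro exI[of _ "Some 0"]) simp
  qed
next
  case (step \<Delta> X a)
  note sc = step.hyps(1) and a = step.hyps(2) and inj = step.prems
  note sc' = simplicial_complex_alexander_dual[OF sc]
  have inj': "inj_on f (X - {a})"
    using inj inj_on_subset by blast
  have card: "card X = Suc (card (X - {a}))"
    using a simplicial_complexD(1)[OF sc] by (metis card_Suc_Diff1)
  let ?d = "\<lambda>n. card (X - {a}) - n - 1" and ?D = "\<lambda>n. card X - n - 1"
  consider "is_cone (lk a \<Delta>) (X - {a})" | "is_cone (dl a \<Delta>) (X - {a})"
    using step.hyps(4) by blast
  then show ?case
  proof cases
    case 1
    obtain t where t: "homotopy_type ((`) f ` dl a \<Delta>) (f ` (X - {a})) t"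
      "homotopy_type ((`) f ` alexander_dual (dl a \<Delta>) (X - {a})) (f ` (X - {a})) (map_option ?d t)"
      "\<forall>n. t = Some n \<longrightarrow> n < card (X - {a})"
      using step.IH(1)[OF inj'] by blast
    \<comment> \<open>\<Delta> keeps the type of its deletion, while the dual, whose deletion is now
      a cone, is suspended.\<close>
    have "is_cone (dl a (alexander_dual \<Delta> X)) (X - {a})"
      unfolding dl_alexander_dual[OF sc a]
      using is_cone_alexander_dual[OF simplicial_complex_lk[OF sc] 1] .
    then have "homotopy_type ((`) f ` alexander_dual \<Delta> X) (f ` X) (map_option Suc (map_option ?d t))"
      using homotopy_type_image_dl_cone[OF inj sc' a] t(2) lk_alexander_dual[OF sc a] by simp
    \<comment> \<open>The bound \<open>n < card (X - {a})\<close> is what lets \<open>Suc\<close>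
      cancel the truncated subtraction of one.\<close>
    moreover have "map_option Suc (map_option ?d t) = map_option ?D t"
      using t(3) card by (cases t) auto
    ultimately show ?thesis
      using homotopy_type_image_lk_cone[OF inj sc a 1 t(1)] t(3) card less_SucI by metis
  next
    case 2
    obtain t where t: "homotopy_type ((`) f ` lk a \<Delta>) (f ` (X - {a})) t"
      "homotopy_type ((`) f ` alexander_dual (lk a \<Delta>) (X - {a})) (f ` (X - {a})) (map_option ?d t)"
      "\<forall>n. t = Some n \<longrightarrow> n < card (X - {a})"
      using step.IH(2)[OF inj'] by blast
    \<comment> \<open>The roles are reversed: \<Delta> is suspended, and the dual keeps the type of
      its deletion.\<close>
    have "is_cone (lk a (alexander_dual \<Delta> X)) (X - {a})"
      unfolding lk_alexander_dual[OF sc a]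
      using is_cone_alexander_dual[OF simplicial_complex_dl(1)[OF sc] 2] .
    then have "homotopy_type ((`) f ` alexander_dual \<Delta> X) (f ` X) (map_option ?d t)"
      using homotopy_type_image_lk_cone[OF inj sc' a] t(2) dl_alexander_dual[OF sc a] by simp
    moreover have "map_option ?d t = map_option ?D (map_option Suc t)"
      using card by (cases t) auto
    moreover have "\<forall>n. map_option Suc t = Some n \<longrightarrow> n < card X"
      using t(3) card by auto
    ultimately show ?thesis
      using homotopy_type_image_dl_cone[OF inj sc a 2 t(1)] by metis
  qed
qed

section \<open>Homology modulo two\<close>

text \<open>This is the boundary map modulo two, with each coface of \<tau> counted through its
  additional vertex. The empty set is allowed as \<tau>, which makes the chain complex
  augmented.\<close>

definition boundary :: "'a set set \<Rightarrow> 'a set set" where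
  "boundary C = {\<tau>. odd (card {x. x \<notin> \<tau> \<and> insert x \<tau> \<in> C})}"

text \<open>Chains with coefficients in the field with two elements are sets of faces. The number
  \<open>n\<close> is the cardinality of the faces, that is, their dimension plus one.\<close>

definition nontrivial_homology :: "'a set set \<Rightarrow> nat \<Rightarrow> bool" where
  "nontrivial_homology K n \<longleftrightarrow>
     (\<exists>C \<subseteq> {\<sigma> \<in> K. card \<sigma> = n}. boundary C = {} \<and>
        (\<forall>D \<subseteq> {\<sigma> \<in> K. card \<sigma> = Suc n}. boundary D \<noteq> C))"

lemma odd_card_sym_diff:
  assumes "finite A" "finite B"
  shows "odd (card (sym_diff A B)) \<longleftrightarrow> odd (card A) \<noteq> odd (card B)"
proof -
  have "card A = card (A - B) + card (A \<inter> B)" "card B = card (B - A) + card (A \<inter> B)"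
    using assms by (metis card_Int_Diff add.commute inf_commute)+
  moreover have "card (sym_diff A B) = card (A - B) + card (B - A)"
    using assms by (intro card_Un_disjoint) auto
  ultimately show ?thesis by simp presburger
qed

text \<open>Symmetric difference is addition modulo two, so this is linearity. Finiteness makes the
  cardinalities genuine counts.\<close>

lemma boundary_sym_diff:
  assumes "finite (\<Union>C)" "finite (\<Union>D)"
  shows "boundary (sym_diff C D) = sym_diff (boundary C) (boundary D)"
proof -
  have "odd (card {x. x \<notin> \<tau> \<and> insert x \<tau> \<in> sym_diff C D}) \<longleftrightarrow>
    odd (card {x. x \<notin> \<tau> \<and> insert x \<tau> \<in> C}) \<noteq> odd (card {x. x \<notin> \<tau> \<and> insert x \<tau> \<in> D})" for \<tau>
  proof -
    let ?S = "\<lambda>C. {x. x \<notin> \<tau> \<and> insert x \<tau> \<in> C}"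
    have "?S C \<subseteq> \<Union>C" "?S D \<subseteq> \<Union>D" by blast+
    then have "finite (?S C)" "finite (?S D)"
      using assms finite_subset by blast+
    moreover have "?S (sym_diff C D) = sym_diff (?S C) (?S D)" by blast
    ultimately show ?thesis
      by (simp only: odd_card_sym_diff)
  qed
  then show ?thesis
    unfolding boundary_def by blast
qed

lemma boundaryE:
  assumes "\<tau> \<in> boundary C"
  obtains x where "x \<notin> \<tau>" "insert x \<tau> \<in> C"
proof -
  have "{x. x \<notin> \<tau> \<and> insert x \<tau> \<in> C} \<noteq> {}"
    using assms odd_card_imp_not_empty unfolding boundary_def by blast
  then show ?thesis using that by blast
qed

lemma boundary_empty [simp]: "boundary {} = {}"
  unfolding boundary_def by simp

lemma boundary_singleton: "boundary {\<sigma>} = (\<lambda>x. \<sigma> - {x}) ` \<sigma>"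
proof (intro set_eqI iffI)
  fix \<tau> assume "\<tau> \<in> boundary {\<sigma>}"
  then obtain x where "x \<notin> \<tau>" "insert x \<tau> = \<sigma>"
    by (auto elim: boundaryE)
  then show "\<tau> \<in> (\<lambda>x. \<sigma> - {x}) ` \<sigma>" by force
next
  fix \<tau> assume "\<tau> \<in> (\<lambda>x. \<sigma> - {x}) ` \<sigma>"
  then obtain y where "y \<in> \<sigma>" "\<tau> = \<sigma> - {y}" by blast
  then have "{x. x \<notin> \<tau> \<and> insert x \<tau> \<in> {\<sigma>}} = {y}" by auto
  then show "\<tau> \<in> boundary {\<sigma>}" unfolding boundary_def by simp
qed

text \<open>A set obtained from \<sigma> by removing two elements \<open>x\<close> and
  \<open>y\<close> lies under exactly two members of the boundary, \<open>\<sigma> - {x}\<close> and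
  \<open>\<sigma> - {y}\<close>.\<close>

lemma boundary_boundary_singleton: "boundary (boundary {\<sigma>}) = {}"
proof -
  have "even (card {x. x \<notin> \<tau> \<and> insert x \<tau> \<in> boundary {\<sigma>}})" for \<tau>
  proof (cases "{x. x \<notin> \<tau> \<and> insert x \<tau> \<in> boundary {\<sigma>}} = {}")
    case False
    then obtain x y where xy: "x \<notin> \<tau>" "y \<in> \<sigma>" "insert x \<tau> = \<sigma> - {y}"
      unfolding boundary_singleton by blast
    then have \<tau>: "\<tau> = \<sigma> - {x, y}" "x \<noteq> y" "x \<in> \<sigma>" by blast+
    have "{z. z \<notin> \<tau> \<and> insert z \<tau> \<in> boundary {\<sigma>}} = {x, y}"
    proof (intro set_eqI iffI)
      fix z assume "z \<in> {z. z \<notin> \<tau> \<and> insert z \<tau> \<in> boundary {\<sigma>}}"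
      then show "z \<in> {x, y}"
        using \<tau> xy unfolding boundary_singleton by blast
    next
      fix z assume "z \<in> {x, y}"
      moreover have "insert x \<tau> = \<sigma> - {y}" "insert y \<tau> = \<sigma> - {x}"
        using \<tau> xy by blast+
      ultimately show "z \<in> {z. z \<notin> \<tau> \<and> insert z \<tau> \<in> boundary {\<sigma>}}"
        using \<tau> xy unfolding boundary_singleton by blast
    qed
    then show ?thesis using \<tau> by simp
  qed (simp only: card.empty even_zero)
  then show ?thesis unfolding boundary_def[of "boundary {\<sigma>}"] by blast
qed

text \<open>Only \<sigma> lies above \<tau>, so a chain whose boundary misses \<tau> cannot contain
  \<sigma>. If it contains \<tau>, adding the boundary of \<sigma> removes \<tau> and leaves the
  boundary of the chain unchanged.\<close>

lemma elementary_collapse_homology: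
  assumes "elementary_collapse K L"
  shows "nontrivial_homology K n \<longleftrightarrow> nontrivial_homology L n"
proof -
  obtain \<sigma> \<tau> where K: "simplicial_complex K (\<Union>K)" and \<sigma>: "\<sigma> \<in> K"
    and \<tau>: "\<tau> \<subset> \<sigma>" "Suc (card \<tau>) = card \<sigma>"
    and free: "\<forall>\<rho>\<in>K. \<tau> \<subset> \<rho> \<longrightarrow> \<rho> = \<sigma>" and L: "L = K - {\<sigma>, \<tau>}"
    using assms unfolding elementary_collapse_def by blast
  note fin = simplicial_complex_finite(3)[OF K]
  have finC: "finite (\<Union>C)" if "C \<subseteq> K" for C
    using that fin by (meson Sup_subset_mono finite_subset)
  have fin\<sigma>: "finite \<sigma>"
    using simplicial_complex_finite(2)[OF K \<sigma>] .
  obtain v where v: "v \<in> \<sigma>" "\<tau> = \<sigma> - {v}"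
  proof -
    have "card (\<sigma> - \<tau>) = 1"
      using \<tau> card_Diff_subset[of \<tau> \<sigma>] finite_subset[OF _ fin\<sigma>, of \<tau>] by force
    then obtain v where "\<sigma> - \<tau> = {v}" by (rule card_1_singletonE)
    then show ?thesis using \<tau>(1) that by blast
  qed
  have \<sigma>C: "\<tau> \<in> boundary C" if "C \<subseteq> K" "\<sigma> \<in> C" for C
  proof -
    have "{x. x \<notin> \<tau> \<and> insert x \<tau> \<in> C} = {v}"
    proof (intro set_eqI iffI)
      fix x assume x: "x \<in> {x. x \<notin> \<tau> \<and> insert x \<tau> \<in> C}"
      then have "insert x \<tau> = \<sigma>"
        using free that(1) by blast
      with x v show "x \<in> {v}" by blast
    next
      fix x assume "x \<in> {v}"
      with v that(2) show "x \<in> {x. x \<notin> \<tau> \<and> insert x \<tau> \<in> C}"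
        by (auto simp: insert_absorb)
    qed
    then show ?thesis unfolding boundary_def by simp
  qed
  let ?b = "boundary {\<sigma>}"
  have b: "\<tau> \<in> ?b" "\<sigma> \<notin> ?b" "?b \<subseteq> K" "\<And>\<rho>. \<rho> \<in> ?b \<Longrightarrow> card \<rho> = card \<tau>"
  proof -
    show "\<tau> \<in> ?b" "\<sigma> \<notin> ?b"
      using v unfolding boundary_singleton by blast+
    show "?b \<subseteq> K"
      using simplicial_complexD(3)[OF K \<sigma>] unfolding boundary_singleton by blast
    show "card \<rho> = card \<tau>" if "\<rho> \<in> ?b" for \<rho>
      using that v fin\<sigma> unfolding boundary_singleton by (auto simp: card_Diff_singleton)
  qed
  \<comment> \<open>The same statement serves to move cycles of \<open>K\<close> into
    \<open>L\<close> and to move fillings of cycles of \<open>L\<close> into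
    \<open>L\<close>.\<close>
  have push: "\<exists>C'. C' \<subseteq> {\<rho> \<in> L. card \<rho> = m} \<and> boundary C' = boundary C \<and>
      (C' = C \<or> C' = sym_diff C ?b \<and> card \<sigma> = Suc m)"
    if C: "C \<subseteq> {\<rho> \<in> K. card \<rho> = m}" "\<tau> \<notin> boundary C" for C m
  proof (cases "\<tau> \<in> C")
    case False
    have "\<sigma> \<notin> C"
      using \<sigma>C[of C] C by blast
    with False C show ?thesis
      unfolding L by blast
  next
    case True
    then have m: "card \<tau> = m" using C by blast
    have "\<sigma> \<notin> C"
      using m \<tau>(2) C by auto
    then have "sym_diff C ?b \<subseteq> {\<rho> \<in> L. card \<rho> = m}"
      using C True b m unfolding L by blast
    moreover have "boundary (sym_diff C ?b) = boundary C"
      using boundary_sym_diff[of C ?b] finC[of C] finC[OF b(3)] C boundary_boundary_singleton[of \<sigma>]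
      by auto
    ultimately show ?thesis
      using m \<tau>(2) by metis
  qed
  show ?thesis
  proof
    assume "nontrivial_homology K n"
    then obtain C where C: "C \<subseteq> {\<sigma> \<in> K. card \<sigma> = n}" "boundary C = {}"
      "\<forall>D \<subseteq> {\<sigma> \<in> K. card \<sigma> = Suc n}. boundary D \<noteq> C"
      unfolding nontrivial_homology_def by blast
    then obtain C' where C': "C' \<subseteq> {\<rho> \<in> L. card \<rho> = n}" "boundary C' = {}"
      "C' = C \<or> C' = sym_diff C ?b \<and> card \<sigma> = Suc n"
      using push[of C n] by auto
    have "boundary D \<noteq> C'" if D: "D \<subseteq> {\<sigma> \<in> L. card \<sigma> = Suc n}" for D
    proof
      assume bD: "boundary D = C'"
      have DK: "D \<subseteq> {\<sigma> \<in> K. card \<sigma> = Suc n}"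
        using D unfolding L by blast
      then have "C' \<noteq> C"
        using C(3) bD by blast
      then have C'': "C' = sym_diff C ?b" "card \<sigma> = Suc n"
        using C'(3) by blast+
      \<comment> \<open>\<open>D\<close> fills the shifted cycle, so adding \<sigma> to it fills the
        original one.\<close>
      have "boundary (sym_diff D {\<sigma>}) = sym_diff (boundary D) ?b"
        using boundary_sym_diff[of D "{\<sigma>}"] finC[of D] DK fin\<sigma> by auto
      then have "boundary (sym_diff D {\<sigma>}) = C"
        unfolding bD C''(1) by blast
      moreover have "sym_diff D {\<sigma>} \<subseteq> {\<sigma> \<in> K. card \<sigma> = Suc n}"
        using DK \<sigma> C''(2) by blast
      ultimately show False
        using C(3) by blast
    qed
    with C' show "nontrivial_homology L n"
      unfolding nontrivial_homology_def by blast
  next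
    assume "nontrivial_homology L n"
    then obtain C where C: "C \<subseteq> {\<sigma> \<in> L. card \<sigma> = n}" "boundary C = {}"
      "\<forall>D \<subseteq> {\<sigma> \<in> L. card \<sigma> = Suc n}. boundary D \<noteq> C"
      unfolding nontrivial_homology_def by blast
    \<comment> \<open>\<open>C\<close> lies in \<open>L\<close> and so misses \<tau>; a filling
      \<open>D\<close> in \<open>K\<close> could therefore be pushed into \<open>L\<close>.\<close>
    have "boundary D \<noteq> C" if "D \<subseteq> {\<sigma> \<in> K. card \<sigma> = Suc n}" for D
      using push[OF that] C(1,3) unfolding L by blast
    moreover have "C \<subseteq> {\<sigma> \<in> K. card \<sigma> = n}"
      using C(1) unfolding L by blast
    ultimately show "nontrivial_homology K n"
      using C(2) unfolding nontrivial_homology_def by blast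
  qed
qed

lemma equivclp_collapse_homology:
  assumes "equivclp elementary_collapse K L"
  shows "nontrivial_homology K n \<longleftrightarrow> nontrivial_homology L n"
  using assms by (induction rule: equivclp_induct) (auto dest: elementary_collapse_homology[of _ _ n])

section \<open>Invariance of homology under isomorphism and simple-homotopy\<close>

lemma boundary_image:
  assumes "inj_on f (\<Union>C)"
  shows "boundary ((`) f ` C) = (`) f ` boundary C"
proof -
  let ?S = "\<lambda>C \<tau>. {x. x \<notin> \<tau> \<and> insert x \<tau> \<in> C}"
  have S: "?S ((`) f ` C) (f ` \<tau>) = f ` ?S C \<tau>" if "\<tau> \<subseteq> \<Union>C" for \<tau>
  proof (intro set_eqI iffI)
    fix y assume y: "y \<in> ?S ((`) f ` C) (f ` \<tau>)"
    then obtain \<sigma> where \<sigma>: "\<sigma> \<in> C" "insert y (f ` \<tau>) = f ` \<sigma>" by blast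
    then obtain x where x: "x \<in> \<sigma>" "y = f x" by blast
    have "f ` insert x \<tau> = f ` \<sigma>" using \<sigma> x by simp
    then have "insert x \<tau> = \<sigma>"
      using inj_on_image_eq_iff[OF assms, of "insert x \<tau>" \<sigma>] that x \<sigma>(1) by blast
    then show "y \<in> f ` ?S C \<tau>"
      using x y \<sigma>(1) by blast
  next
    fix y assume "y \<in> f ` ?S C \<tau>"
    then obtain x where x: "x \<notin> \<tau>" "insert x \<tau> \<in> C" "y = f x" by blast
    moreover have "f x \<notin> f ` \<tau>"
      using inj_on_image_mem_iff[OF assms, of x \<tau>] x that by blast
    moreover have "insert (f x) (f ` \<tau>) \<in> (`) f ` C"
      using x(2) by (metis image_eqI image_insert)
    ultimately show "y \<in> ?S ((`) f ` C) (f ` \<tau>)" by simp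
  qed
  have card: "card (f ` ?S C \<tau>) = card (?S C \<tau>)" for \<tau>
    using assms by (intro card_image) (auto elim!: inj_on_subset)
  have mem: "f ` \<tau> \<in> boundary ((`) f ` C) \<longleftrightarrow> \<tau> \<in> boundary C" if "\<tau> \<subseteq> \<Union>C" for \<tau>
    unfolding boundary_def mem_Collect_eq S[OF that] card ..
  show ?thesis
  proof (intro set_eqI iffI)
    fix \<rho> assume \<rho>: "\<rho> \<in> boundary ((`) f ` C)"
    then obtain y where "insert y \<rho> \<in> (`) f ` C"
      by (rule boundaryE)
    then obtain \<sigma> where "insert y \<rho> = f ` \<sigma>" "\<sigma> \<in> C" by blast
    moreover from this have "\<rho> \<subseteq> f ` \<sigma>" by blast
    then obtain \<tau> where "\<tau> \<subseteq> \<sigma>" "\<rho> = f ` \<tau>" by (rule subset_imageE)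
    ultimately have "\<tau> \<subseteq> \<Union>C" by blast
    then show "\<rho> \<in> (`) f ` boundary C"
      using mem \<rho> \<open>\<rho> = f ` \<tau>\<close> by blast
  next
    fix \<rho> assume "\<rho> \<in> (`) f ` boundary C"
    then obtain \<tau> where \<tau>: "\<tau> \<in> boundary C" "\<rho> = f ` \<tau>" by blast
    from \<tau>(1) have "\<tau> \<subseteq> \<Union>C"
      by (blast elim: boundaryE)
    then show "\<rho> \<in> boundary ((`) f ` C)"
      using \<tau> mem by blast
  qed
qed

lemma complex_iso_sym:
  assumes "complex_iso K L"
  shows "complex_iso L K"
proof -
  obtain f where f: "inj_on f (\<Union>K)" "L = (`) f ` K"
    using assms unfolding complex_iso_def by blast
  let ?g = "inv_into (\<Union>K) f"
  have "\<Union>L = f ` \<Union>K"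
    unfolding f(2) by blast
  then have "inj_on ?g (\<Union>L)"
    using inj_on_inv_into[of "\<Union>L" f "\<Union>K"] by simp
  moreover have "?g ` f ` \<sigma> = \<sigma>" if "\<sigma> \<in> K" for \<sigma>
    using f(1) that by (intro inv_into_image_cancel) auto
  then have "K = (`) ?g ` L"
    unfolding f(2) image_image by simp
  ultimately show ?thesis
    unfolding complex_iso_def by blast
qed

lemma complex_iso_homology_imp:
  assumes "complex_iso K L" "nontrivial_homology K n"
  shows "nontrivial_homology L n"
proof -
  obtain f where f: "inj_on f (\<Union>K)" "L = (`) f ` K"
    using assms(1) unfolding complex_iso_def by blast
  obtain C where C: "C \<subseteq> {\<sigma> \<in> K. card \<sigma> = n}" "boundary C = {}"
    "\<forall>D \<subseteq> {\<sigma> \<in> K. card \<sigma> = Suc n}. boundary D \<noteq> C"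
    using assms(2) unfolding nontrivial_homology_def by blast
  have inj: "inj_on f (\<Union>C)" if "C \<subseteq> K" for C
    using that by (intro inj_on_subset[OF f(1)]) blast
  have card: "card (f ` \<sigma>) = card \<sigma>" if "\<sigma> \<in> K" for \<sigma>
    using that by (intro card_image inj_on_subset[OF f(1)]) blast
  have CK: "C \<subseteq> K"
    using C(1) by blast
  have "boundary ((`) f ` C) = {}"
    using boundary_image[OF inj[OF CK]] C(2) by simp
  moreover have "(`) f ` C \<subseteq> {\<sigma> \<in> L. card \<sigma> = n}"
    using C(1) card f(2) by auto
  moreover have "boundary D' \<noteq> (`) f ` C" if D': "D' \<subseteq> {\<sigma> \<in> L. card \<sigma> = Suc n}" for D'
  proof
    assume bD': "boundary D' = (`) f ` C"
    have "D' \<subseteq> (`) f ` K"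
      using D' f(2) by blast
    then obtain D where D: "D \<subseteq> K" "D' = (`) f ` D"
      by (rule subset_imageE)
    have "(`) f ` boundary D = (`) f ` C"
      using boundary_image[OF inj[OF D(1)]] bD' D(2) by simp
    moreover have "boundary D \<subseteq> Pow (\<Union>K)"
      using D(1) by (blast elim: boundaryE)
    moreover have "C \<subseteq> Pow (\<Union>K)"
      using CK by blast
    ultimately have "boundary D = C"
      using inj_on_image_eq_iff[OF inj_on_image_Pow[OF f(1)], of "boundary D" C] by simp
    moreover have "D \<subseteq> {\<sigma> \<in> K. card \<sigma> = Suc n}"
    proof
      fix \<sigma> assume \<sigma>: "\<sigma> \<in> D"
      then have "f ` \<sigma> \<in> D'"
        using D(2) by blast
      then show "\<sigma> \<in> {\<sigma> \<in> K. card \<sigma> = Suc n}"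
        using \<sigma> D(1) D' card by (metis (mono_tags, lifting) mem_Collect_eq subsetD)
    qed
    ultimately show False
      using C(3) by blast
  qed
  ultimately show ?thesis
    unfolding nontrivial_homology_def by blast
qed

lemma simple_homotopy_equiv_homology:
  assumes "simple_homotopy_equiv \<Delta> \<Gamma>"
  shows "nontrivial_homology \<Delta> n \<longleftrightarrow> nontrivial_homology \<Gamma> n"
  using assms equivclp_collapse_homology complex_iso_homology_imp complex_iso_sym
  unfolding simple_homotopy_equiv_def by metis

section \<open>Homology of the void complex and of cross-polytopes\<close>

lemma nontrivial_homology_void: "\<not> nontrivial_homology {} n"
  using boundary_empty unfolding nontrivial_homology_def by blast

text \<open>The sum of all facets is the fundamental cycle of the sphere. Cofaces of a set
  containing one pole correspond to cofaces, within \<open>B\<close>, of the set without that pole,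
  and their number is even by induction. A set avoiding both poles has exactly two cofaces if it is
  a facet of \<open>B\<close>, and none otherwise.\<close>

lemma cross_polytope_facets_cycle:
  assumes "cross_polytope n B"
  shows "{\<sigma> \<in> B. card \<sigma> = n} \<noteq> {} \<and> boundary {\<sigma> \<in> B. card \<sigma> = n} = {}"
  using assms
proof (induction rule: cross_polytope.induct)
  case zero
  show ?case by (auto simp: boundary_def)
next
  case (suspend n B x y)
  let ?F = "{\<sigma> \<in> B. card \<sigma> = n}" and ?F' = "{\<sigma> \<in> join B (S0 x y). card \<sigma> = Suc n}"
  have F: "x \<notin> \<sigma>" "y \<notin> \<sigma>" "finite \<sigma>" "card \<sigma> \<le> n" if "\<sigma> \<in> B" for \<sigma>
    using that suspend.hyps cross_polytope_card_le[OF suspend.hyps(1)]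
      simplicial_complex_finite(2)[OF cross_polytope_simplicial_complex[OF suspend.hyps(1)]]
    by blast+
  have F': "?F' = insert x ` ?F \<union> insert y ` ?F"
    using F by (fastforce simp: mem_join_S0_iff)
  have apex: "even (card {z. z \<notin> \<tau> \<and> insert z \<tau> \<in> insert p ` ?F \<union> insert q ` ?F})"
    if p: "p \<in> \<tau>" and pq: "p \<noteq> q" and FF: "\<And>\<sigma>. \<sigma> \<in> ?F \<Longrightarrow> p \<notin> \<sigma> \<and> q \<notin> \<sigma>" for p q \<tau>
  proof -
    have "{z. z \<notin> \<tau> \<and> insert z \<tau> \<in> insert p ` ?F \<union> insert q ` ?F} =
      {z. z \<notin> \<tau> - {p} \<and> insert z (\<tau> - {p}) \<in> ?F}"
    proof (intro set_eqI iffI)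
      fix z assume z: "z \<in> {z. z \<notin> \<tau> \<and> insert z \<tau> \<in> insert p ` ?F \<union> insert q ` ?F}"
      then have "insert z \<tau> \<notin> insert q ` ?F"
        using p pq FF by blast
      then obtain \<sigma> where \<sigma>: "\<sigma> \<in> ?F" "insert z \<tau> = insert p \<sigma>"
        using z by blast
      have "insert z (\<tau> - {p}) = insert z \<tau> - {p}" "insert p \<sigma> - {p} = \<sigma>"
        using FF[OF \<sigma>(1)] z p by blast+
      then have "insert z (\<tau> - {p}) = \<sigma>"
        using \<sigma>(2) by simp
      with \<sigma> z show "z \<in> {z. z \<notin> \<tau> - {p} \<and> insert z (\<tau> - {p}) \<in> ?F}"
        by blast
    next
      fix z assume z: "z \<in> {z. z \<notin> \<tau> - {p} \<and> insert z (\<tau> - {p}) \<in> ?F}"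
      then have "z \<noteq> p"
        using FF by blast
      moreover have "insert z \<tau> = insert p (insert z (\<tau> - {p}))"
        using p by blast
      ultimately show "z \<in> {z. z \<notin> \<tau> \<and> insert z \<tau> \<in> insert p ` ?F \<union> insert q ` ?F}"
        using z by blast
    qed
    moreover have "\<tau> - {p} \<notin> boundary ?F"
      using suspend.IH by blast
    ultimately show ?thesis
      unfolding boundary_def by simp
  qed
  have "even (card {z. z \<notin> \<tau> \<and> insert z \<tau> \<in> ?F'})" for \<tau>
  proof -
    consider "x \<in> \<tau>" | "y \<in> \<tau>" | "x \<notin> \<tau>" "y \<notin> \<tau>" by blast
    then show ?thesis
    proof cases
      case 1
      then show ?thesis
        unfolding F' using suspend.hyps(2) F by (intro apex) auto
    next
      case 2
      then show ?thesis
        unfolding F' using suspend.hyps(2) F by (subst Un_commute, intro apex) auto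
    next
      case 3
      have "{z. z \<notin> \<tau> \<and> insert z \<tau> \<in> ?F'} = (if \<tau> \<in> ?F then {x, y} else {})"
      proof -
        have "z \<in> {x, y} \<and> \<tau> \<in> ?F" if z: "z \<notin> \<tau>" "insert z \<tau> \<in> ?F'" for z
        proof -
          obtain p \<sigma> where p: "p \<in> {x, y}" "\<sigma> \<in> ?F" "insert z \<tau> = insert p \<sigma>"
            using z(2) unfolding F' by blast
          then have "p \<notin> \<sigma>" "p \<notin> \<tau>" "p \<in> insert z \<tau>"
            using F(1,2)[of \<sigma>] 3 by auto
          then have "z = p"
            by simp
          then have "\<tau> = \<sigma>"
            using p(3) z(1) \<open>p \<notin> \<sigma>\<close> by (simp add: insert_ident)
          with p(1,2) \<open>z = p\<close> show ?thesis by simp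
        qed
        moreover have "insert x \<tau> \<in> ?F'" "insert y \<tau> \<in> ?F'" if "\<tau> \<in> ?F"
          using that unfolding F' by blast+
        ultimately show ?thesis
          using 3 by (cases "\<tau> \<in> ?F") (simp only: if_True, blast, simp only: if_False, blast)
      qed
      then show ?thesis
        using suspend.hyps(2) by simp
    qed
  qed
  then have "boundary ?F' = {}"
    unfolding boundary_def by blast
  moreover have "?F' \<noteq> {}"
    unfolding F' using suspend.IH by blast
  ultimately show ?case by blast
qed

text \<open>No face has more than \<open>n\<close> elements, so nothing can bound the facet cycle.
  Above \<open>n\<close> the only chain is the empty one, the boundary of the empty chain. Of two
  different parameters, the larger is thus a degree in which only one complex has homology.\<close>

lemma cross_polytope_homology:
  assumes "cross_polytope n B"
  shows "nontrivial_homology B n" "n < m \<Longrightarrow> \<not> nontrivial_homology B m"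
proof -
  have empty: "{\<sigma> \<in> B. card \<sigma> = m} = {}" if "n < m" for m
    using that cross_polytope_card_le[OF assms] by fastforce
  let ?F = "{\<sigma> \<in> B. card \<sigma> = n}"
  note F = cross_polytope_facets_cycle[OF assms]
  have "boundary D \<noteq> ?F" if "D \<subseteq> {\<sigma> \<in> B. card \<sigma> = Suc n}" for D
  proof -
    have "boundary D = {}"
      using that unfolding empty[OF lessI] by simp
    then show ?thesis
      using F by metis
  qed
  then have "?F \<subseteq> ?F \<and> boundary ?F = {} \<and> (\<forall>D \<subseteq> {\<sigma> \<in> B. card \<sigma> = Suc n}. boundary D \<noteq> ?F)"
    using F by simp
  then show "nontrivial_homology B n"
    unfolding nontrivial_homology_def by (rule exI)
  show "\<not> nontrivial_homology B m" if less: "n < m"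
  proof
    assume "nontrivial_homology B m"
    then obtain C where C: "C \<subseteq> {}" "\<forall>D \<subseteq> {\<sigma> \<in> B. card \<sigma> = Suc m}. boundary D \<noteq> C"
      unfolding nontrivial_homology_def empty[OF less] by blast
    then have "boundary {} \<noteq> C"
      by blast
    with C(1) show False
      by simp
  qed
qed

lemma cross_polytope_boundary_homology_unique:
  assumes "simple_homotopy_equiv \<Delta> (cross_polytope_boundary m)"
    "simple_homotopy_equiv \<Delta> (cross_polytope_boundary n)"
  shows "m = n"
  using simple_homotopy_equiv_homology[OF assms(1)] simple_homotopy_equiv_homology[OF assms(2)]
    cross_polytope_homology[OF cross_polytope_cross_polytope_boundary] by (metis linorder_neqE_nat)

lemma cross_polytope_boundary_not_void:
  assumes "simple_homotopy_equiv \<Delta> (cross_polytope_boundary n)"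
  shows "\<not> simple_homotopy_equiv \<Delta> ({} :: 'b set set)"
  using simple_homotopy_equiv_homology[OF assms] nontrivial_homology_void
    cross_polytope_homology(1)[OF cross_polytope_cross_polytope_boundary]
    simple_homotopy_equiv_homology[of \<Delta> "{} :: 'b set set"] by blast

theorem corollary5p4:
  fixes \<Delta> :: "'a set set" and X :: "'a set"
  assumes "strong_combinatorial_grape \<Delta> X"
    and "card X > 0"
  shows "(simple_homotopy_equiv \<Delta> ({} :: nat set set) \<longrightarrow>
            strong_combinatorial_grape (alexander_dual \<Delta> X) X \<and>
            simple_homotopy_equiv (alexander_dual \<Delta> X) ({} :: nat set set)) \<and>
         (\<forall>n. simple_homotopy_equiv \<Delta> (cross_polytope_boundary n) \<longrightarrow>
            strong_combinatorial_grape (alexander_dual \<Delta> X) X \<and>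
            n + 1 \<le> card X \<and>
            simple_homotopy_equiv (alexander_dual \<Delta> X)
              (cross_polytope_boundary (card X - n - 1)))"
proof -
  note sc = grape_simplicial_complex[OF assms(1)]
  note sc' = simplicial_complex_alexander_dual[OF sc]
  obtain f :: "'a \<Rightarrow> nat" where f: "inj_on f X"
    using finite_imp_inj_to_nat_seg[OF simplicial_complexD(1)[OF sc]] by blast
  obtain t where t: "homotopy_type ((`) f ` \<Delta>) (f ` X) t"
    "homotopy_type ((`) f ` alexander_dual \<Delta> X) (f ` X) (map_option (\<lambda>n. card X - n - 1) t)"
    "\<forall>n. t = Some n \<longrightarrow> n < card X"
    using grape_homotopy_types[OF assms f] by blast
  note types = homotopy_type_simple_homotopy_equiv[OF t(1) f sc]
    homotopy_type_simple_homotopy_equiv[OF t(2) f sc']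
  \<comment> \<open>Homology forces any type assumed for \<Delta> to be the type \<open>t\<close>
    found by induction. In each case one of the two implications is vacuous, or holds for a single
    \<open>n\<close>, and the other is read off from the type of the dual.\<close>
  show ?thesis
  proof (cases t)
    case None
    then show ?thesis
      using types cross_polytope_boundary_not_void[of \<Delta>] grape_alexander_dual[OF assms] by auto
  next
    case (Some m)
    then have "simple_homotopy_equiv \<Delta> (cross_polytope_boundary m)"
      using types(1) by simp
    then show ?thesis
      using types(2) Some t(3) cross_polytope_boundary_not_void
        cross_polytope_boundary_homology_unique grape_alexander_dual[OF assms]
      by fastforce
  qed
qed

end
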